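(* Let $I$ be a past interval, $E$ a Banach space, $H\subset\mathrm{Map}(I,E)$ a history space, and $F\colon\mathbb{R}\times H\supset\mathrm{dom}(F)\to E$ a map. Suppose that (i) $H$ is $C^1$-prolongable and regulated by $C^1$-prolongations, (ii) $F$ is continuous, and (iii) $\mathrm{dom}(F)$ is a uniform neighborhood by $C^1$-prolongations of each $(t_0,\phi_0)\in\mathrm{dom}(F)$. If $F$ is uniformly locally Lipschitzian about $C^1$-prolongations, and if the map $$\mathbb{R}_+\times E\times H\ni(t,v,\phi)\mapsto S_v(t)\phi\in H$$ is continuous, then the initial value problem $$\dot x(t)=F(t,I_tx)\quad(t\ge t_0),\qquad I_{t_0}x=\phi_0,\qquad(t_0,\phi_0)\in\mathrm{dom}(F),$$ is maximally well-posed for $C^1$-solutions.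
   Context: Basic notation. $E=(E,\|\cdot\|_E)$ is a Banach space, $\mathbb{R}_+=[0,\infty)$, $\mathbb{R}_-=(-\infty,0]$. A past interval is an interval $I\subset\mathbb{R}_-$ with $0\in I$. $\mathrm{Map}(I,E)$ is the linear space of all maps $I\to E$; $\boldsymbol 0$ is the zero map. For an interval $J$, $J+I=\{t+\theta:t\in J,\theta\in I\}$. If $\gamma$ is an $E$-valued map defined on $J+I$ and $t\in J$, then $I_t\gamma\in\mathrm{Map}(I,E)$ is $I_t\gamma(\theta)=\gamma(t+\theta)$. A history space is a linear subspace $H\subset\mathrm{Map}(I,E)$ with a topology for which the linear operations are continuous. Prolongations. For $(\sigma,\psi)\in\mathbb{R}\times\mathrm{Map}(I,E)$, a $C^1$-prolongation of $(\sigma,\psi)$ is a map $\gamma\colon J+I\to E$, where $J$ is an interval with left end point $\sigma\in J$ ($J=\{\sigma\}$ allowed, any such map then counting as $C^1$), with $I_\sigma\gamma=\psi$ and $\gamma|_J$ of class $C^1$ (one-sided derivatives at end points). A $C^1$-prolongation of $\psi$ is one of $(0,\psi)$. For $v\in E$, $\psi^{\wedge v}\colon\mathbb{R}_++I\to E$ is $\psi^{\wedge v}(t)=\psi(t)$ for $t\in I$ and $\psi^{\wedge v}(t)=\psi(0)+tv$ for $t\ge0$. For $t\ge 0$, $S_v(t)\phi:=I_t[\phi^{\wedge v}]$. $\|g\|_{C^1[0,T]}=\sup_{[0,T]}\|g\|_E+\sup_{[0,T]}\|g'\|_E$. For $T>0$, $0\le\delta\le\infty$, $v\in E$, $\varGamma^1_{\sigma,\psi}(T,\delta,v)$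 is the set of $C^1$-prolongations $\gamma\colon[\sigma,\sigma+T]+I\to E$ of $(\sigma,\psi)$ with $\|\gamma(\sigma+\cdot)-\psi^{\wedge v}(\cdot)\|_{C^1[0,T]}\le\delta$ and $\gamma'(\sigma)=v$ (right derivative); $\varGamma^1_{\sigma,\psi}(0,\delta,v)=\{\psi(\cdot-\sigma)\colon\sigma+I\to E\}$. The rectangle by $C^1$-prolongations is $$\varLambda^1_{\sigma,\psi}(T,\delta,v)=\bigcup_{\tau\in[0,T]}\{(\sigma+\tau,I_{\sigma+\tau}\gamma):\gamma\in\varGamma^1_{\sigma,\psi}(\tau,\delta,v)\}.$$ For $(\sigma,\psi)\in\mathrm{dom}(F)$, $\varLambda^1_{\sigma,\psi}(T,\delta;F):=\varLambda^1_{\sigma,\psi}(T,\delta,F(\sigma,\psi))$. Properties of $H$. $H$ is closed under $C^1$-prolongations if $I_t\gamma\in H$ for all $t\ge0$, for every $\psi\in H$ and every $C^1$-prolongation $\gamma\colon\mathbb{R}_++I\to E$ of $\psi$. $H$ is $C^1$-prolongable if moreover $t\mapsto I_t\gamma\in H$ is continuous on $\mathbb{R}_+$ for all such $\gamma$. $H$ is regulated by $C^1$-prolongations if for every $T>0$ and every neighborhood $N$ of $\boldsymbol 0$ in $H$ there is $\delta>0$ with $\varLambda^1_{0,\boldsymbol 0}(T,\delta,0)\subset[0,T]\times N$. $W\subset\mathbb{R}\times H$ is a uniform neighborhood by $C^1$-prolongations of $(\sigma_0,\psi_0)$ if for every $v_0\in E$ there are $T,\delta>0$, a neighborhood $W_0$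 of $(\sigma_0,\psi_0)$ in $W$, and a neighborhood $V_0$ of $v_0$ in $E$ with $\bigcup_{(\sigma,\psi,v)\in W_0\times V_0}\varLambda^1_{\sigma,\psi}(T,\delta,v)\subset W$. Lipschitz condition. For $L>0$ and $(t,\phi_1),(t,\phi_2)\in\mathrm{dom}(F)$ with $\mathrm{supp}(\phi_1-\phi_2)$ compact, $L$-(Lip) is the inequality $\|F(t,\phi_1)-F(t,\phi_2)\|_E\le L\|\phi_1-\phi_2\|_\infty$ (sup norm over $I$). $F$ is uniformly locally Lipschitzian about $C^1$-prolongations if for every $(\sigma_0,\psi_0)\in\mathrm{dom}(F)$ there are a neighborhood $W_0$ of $(\sigma_0,\psi_0)$ in $\mathrm{dom}(F)$ and $T,\delta,L>0$ such that $L$-(Lip) holds for all $(\sigma,\psi)\in W_0$ and all $(t,\phi_1),(t,\phi_2)\in\varLambda^1_{\sigma,\psi}(T,\delta;F)\cap\mathrm{dom}(F)$. Solutions. For $(t_0,\phi_0)\in\mathrm{dom}(F)$, a solution of the initial value problem is a map $x\colon J+I\to E$, $J$ a non-degenerate interval with left end point $t_0\in J$, such that $I_{t_0}x=\phi_0$, $(t,I_tx)\in\mathrm{dom}(F)$ for all $t\in J$, and $x|_J$ is differentiable with $(x|_J)'(t)=F(t,I_tx)$ for all $t\in J$. It is a $C^1$-solution if $x|_J$ is $C^1$. $C^1$-solutions $x_i\colon J_i+I\to E$ are partially ordered by: $x_1\le x_2$ iff $J_1\subset J_2$ and $x_1|_{J_1}=x_2|_{J_1}$; a maximal $C^1$-solution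 is a maximal element. Maximal well-posedness. A maximal semiflow in a topological space $X$ is a map $\varPhi\colon\mathbb{R}_+\times X\supset\mathrm{dom}(\varPhi)\to X$ such that (1) $\mathrm{dom}(\varPhi)=\bigcup_{x\in X}[0,T(x))\times\{x\}$ for some function $T\colon X\to(0,\infty]$; (2) $\varPhi(0,x)=x$; (3) if $(t_1,x)\in\mathrm{dom}(\varPhi)$ and $(t_2,\varPhi(t_1,x))\in\mathrm{dom}(\varPhi)$, then $(t_1+t_2,x)\in\mathrm{dom}(\varPhi)$ and $\varPhi(t_1+t_2,x)=\varPhi(t_2,\varPhi(t_1,x))$. It is a continuous maximal semiflow if moreover $\mathrm{dom}(\varPhi)$ is open in $\mathbb{R}_+\times X$ and $\varPhi$ is continuous. For $\varOmega\subset\mathbb{R}\times X$ (subspace topology), a map $\mathcal{P}\colon\mathbb{R}_+\times\varOmega\supset\mathrm{dom}(\mathcal{P})\to X$ is a continuous maximal process in $\varOmega$ if $\overline{\mathcal{P}}(\tau,(t,x))=(t+\tau,\mathcal{P}(\tau,t,x))$ on $\mathrm{dom}(\mathcal{P})$ defines a continuous maximal semiflow in $\varOmega$. The initial value problem is maximally well-posed for $C^1$-solutions if (1) for every $(t_0,\phi_0)\in\mathrm{dom}(F)$ there is a unique maximal $C^1$-solution $x_F(\cdot;t_0,\phi_0)\colon[t_0,t_0+T_F(t_0,\phi_0))+I\to E$ with $0<T_F(t_0,\phi_0)\le\infty$; and (2) the solution process $\mathcal{P}_F$, with $\mathrm{dom}(\mathcal{P}_F)=\bigcup_{(t_0,\phi_0)\in\mathrm{dom}(F)}[0,T_F(t_0,\phi_0))\times\{(t_0,\phi_0)\}$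 and $\mathcal{P}_F(\tau,t_0,\phi_0)=I_{t_0+\tau}[x_F(\cdot;t_0,\phi_0)]\in H$, is a continuous maximal process in $\mathrm{dom}(F)$. *)

theory Defs
  imports "HOL-Analysis.Analysis"
begin

section \<open>Maps, segments, history spaces\<close>

definition past_interval :: "real set \<Rightarrow> bool" where
  "past_interval I \<longleftrightarrow> is_interval I \<and> I \<subseteq> {..0} \<and> 0 \<in> I"

text \<open>
  A map \<open>A \<rightarrow> E\<close> is represented by the unique total function that extends it by \<open>0\<close> off \<open>A\<close>, so that
  equality of maps is equality of functions and the linear structure is the pointwise one.
  The domain \<open>J + I\<close> below is the elementwise sum of sets.
\<close>

definition Maps :: "real set \<Rightarrow> (real \<Rightarrow> 'e::real_normed_vector) set" where
  "Maps A = {f. \<forall>t. t \<notin> A \<longrightarrow> f t = 0}"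

definition seg :: "real set \<Rightarrow> real \<Rightarrow> (real \<Rightarrow> 'e::real_normed_vector) \<Rightarrow> (real \<Rightarrow> 'e)" where
  "seg I t \<gamma> = (\<lambda>\<theta>. if \<theta> \<in> I then \<gamma> (t + \<theta>) else 0)"

text \<open>The topology of a history space is not assumed to be Hausdorff.\<close>

definition history_space :: "real set \<Rightarrow> (real \<Rightarrow> 'e::real_normed_vector) topology \<Rightarrow> bool" where
  "history_space I H \<longleftrightarrow>
     topspace H \<subseteq> Maps I \<and>
     (\<lambda>_. 0) \<in> topspace H \<and>
     (\<forall>\<phi>\<in>topspace H. \<forall>\<psi>\<in>topspace H. (\<lambda>\<theta>. \<phi> \<theta> + \<psi> \<theta>) \<in> topspace H) \<and>
     (\<forall>c. \<forall>\<phi>\<in>topspace H. (\<lambda>\<theta>. c *\<^sub>R \<phi> \<theta>) \<in> topspace H) \<and>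
     continuous_map (prod_topology H H) H (\<lambda>(\<phi>, \<psi>). (\<lambda>\<theta>. \<phi> \<theta> + \<psi> \<theta>)) \<and>
     continuous_map (prod_topology euclideanreal H) H (\<lambda>(c, \<phi>). (\<lambda>\<theta>. c *\<^sub>R \<phi> \<theta>))"

text \<open>Neighborhoods need not be open.\<close>

definition nbhd :: "'a topology \<Rightarrow> 'a \<Rightarrow> 'a set \<Rightarrow> bool" where
  "nbhd X x N \<longleftrightarrow> N \<subseteq> topspace X \<and> x \<in> X interior_of N"

section \<open>Prolongations\<close>

text \<open>Derivatives within \<open>J\<close> are one-sided at end points; for \<open>J = {\<sigma>}\<close> every map is \<open>C1_on J\<close>.\<close>

definition C1_on :: "real set \<Rightarrow> (real \<Rightarrow> 'e::real_normed_vector) \<Rightarrow> bool" where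
  "C1_on J f \<longleftrightarrow>
     (\<exists>f'. continuous_on J f' \<and> (\<forall>t\<in>J. (f has_vector_derivative f' t) (at t within J)))"

definition left_end_interval :: "real \<Rightarrow> real set \<Rightarrow> bool" where
  "left_end_interval \<sigma> J \<longleftrightarrow> is_interval J \<and> \<sigma> \<in> J \<and> J \<subseteq> {\<sigma>..}"

definition C1_prolongation ::
  "real set \<Rightarrow> real \<Rightarrow> (real \<Rightarrow> 'e::real_normed_vector) \<Rightarrow> real set \<Rightarrow> (real \<Rightarrow> 'e) \<Rightarrow> bool" where
  "C1_prolongation I \<sigma> \<psi> J \<gamma> \<longleftrightarrow>
     left_end_interval \<sigma> J \<and> \<gamma> \<in> Maps (J + I) \<and> seg I \<sigma> \<gamma> = \<psi> \<and> C1_on J \<gamma>"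

definition affine_prolong ::
  "(real \<Rightarrow> 'e::real_normed_vector) \<Rightarrow> 'e \<Rightarrow> (real \<Rightarrow> 'e)" where
  "affine_prolong \<psi> v = (\<lambda>t. if t \<ge> 0 then \<psi> 0 + t *\<^sub>R v else \<psi> t)"

definition S_shift ::
  "real set \<Rightarrow> 'e::real_normed_vector \<Rightarrow> real \<Rightarrow> (real \<Rightarrow> 'e) \<Rightarrow> (real \<Rightarrow> 'e)" where
  "S_shift I v t \<phi> = seg I t (affine_prolong \<phi> v)"

definition C1_norm :: "real \<Rightarrow> (real \<Rightarrow> 'e::real_normed_vector) \<Rightarrow> ennreal" where
  "C1_norm T g =
     (SUP s\<in>{0..T}. ennreal (norm (g s))) +
     (SUP s\<in>{0..T}. ennreal (norm (vector_derivative g (at s within {0..T}))))"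

definition Gamma1 ::
  "real set \<Rightarrow> real \<Rightarrow> (real \<Rightarrow> 'e::real_normed_vector) \<Rightarrow> real \<Rightarrow> ennreal \<Rightarrow> 'e \<Rightarrow> (real \<Rightarrow> 'e) set" where
  "Gamma1 I \<sigma> \<psi> T \<delta> v =
     (if T = 0 then {\<lambda>t. \<psi> (t - \<sigma>)}
      else {\<gamma>. C1_prolongation I \<sigma> \<psi> {\<sigma>..\<sigma> + T} \<gamma> \<and>
               C1_norm T (\<lambda>s. \<gamma> (\<sigma> + s) - affine_prolong \<psi> v s) \<le> \<delta> \<and>
               (\<gamma> has_vector_derivative v) (at \<sigma> within {\<sigma>..\<sigma> + T})})"

definition Lambda1 ::
  "real set \<Rightarrow> real \<Rightarrow> (real \<Rightarrow> 'e::real_normed_vector) \<Rightarrow> real \<Rightarrow> ennreal \<Rightarrow> 'e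
     \<Rightarrow> (real \<times> (real \<Rightarrow> 'e)) set" where
  "Lambda1 I \<sigma> \<psi> T \<delta> v =
     (\<Union>\<tau>\<in>{0..T}. {(\<sigma> + \<tau>, seg I (\<sigma> + \<tau>) \<gamma>) | \<gamma>. \<gamma> \<in> Gamma1 I \<sigma> \<psi> \<tau> \<delta> v})"

section \<open>Properties of the history space and of the domain\<close>

definition closed_under_C1_prolongations ::
  "real set \<Rightarrow> (real \<Rightarrow> 'e::real_normed_vector) topology \<Rightarrow> bool" where
  "closed_under_C1_prolongations I H \<longleftrightarrow>
     (\<forall>\<psi>\<in>topspace H. \<forall>\<gamma>. C1_prolongation I 0 \<psi> {0..} \<gamma> \<longrightarrow> (\<forall>t\<ge>0. seg I t \<gamma> \<in> topspace H))"

definition C1_prolongable ::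
  "real set \<Rightarrow> (real \<Rightarrow> 'e::real_normed_vector) topology \<Rightarrow> bool" where
  "C1_prolongable I H \<longleftrightarrow>
     closed_under_C1_prolongations I H \<and>
     (\<forall>\<psi>\<in>topspace H. \<forall>\<gamma>. C1_prolongation I 0 \<psi> {0..} \<gamma> \<longrightarrow>
        continuous_map (top_of_set {0..}) H (\<lambda>t. seg I t \<gamma>))"

definition regulated_by_C1_prolongations ::
  "real set \<Rightarrow> (real \<Rightarrow> 'e::real_normed_vector) topology \<Rightarrow> bool" where
  "regulated_by_C1_prolongations I H \<longleftrightarrow>
     (\<forall>T>0. \<forall>N. nbhd H (\<lambda>_. 0) N \<longrightarrow>
        (\<exists>\<delta>>0. Lambda1 I 0 (\<lambda>_. 0) T \<delta> 0 \<subseteq> {0..T} \<times> N))"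

definition uniform_nbhd_by_C1_prolongations ::
  "real set \<Rightarrow> (real \<Rightarrow> 'e::real_normed_vector) topology \<Rightarrow> (real \<times> (real \<Rightarrow> 'e)) set
     \<Rightarrow> real \<times> (real \<Rightarrow> 'e) \<Rightarrow> bool" where
  "uniform_nbhd_by_C1_prolongations I H W p0 \<longleftrightarrow>
     (\<forall>v0. \<exists>T>0. \<exists>\<delta>>0. \<exists>W0 V0.
        nbhd (subtopology (prod_topology euclideanreal H) W) p0 W0 \<and>
        nbhd euclidean v0 V0 \<and>
        (\<Union>(\<sigma>, \<psi>)\<in>W0. \<Union>v\<in>V0. Lambda1 I \<sigma> \<psi> T \<delta> v) \<subseteq> W)"

section \<open>The Lipschitz condition\<close>

text \<open>A partial map \<open>F\<close> is given by its domain \<open>D\<close> and a total function; values off \<open>D\<close> are never used.\<close>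

text \<open>The support of a map on \<open>I\<close> is its closed support relative to \<open>I\<close>.\<close>

definition supp_on :: "real set \<Rightarrow> (real \<Rightarrow> 'e::real_normed_vector) \<Rightarrow> real set" where
  "supp_on I f = top_of_set I closure_of {\<theta> \<in> I. f \<theta> \<noteq> 0}"

definition Lip_ineq ::
  "real set \<Rightarrow> (real \<times> (real \<Rightarrow> 'e::real_normed_vector) \<Rightarrow> 'e) \<Rightarrow> real \<Rightarrow> real
     \<Rightarrow> (real \<Rightarrow> 'e) \<Rightarrow> (real \<Rightarrow> 'e) \<Rightarrow> bool" where
  "Lip_ineq I F L t \<phi>1 \<phi>2 \<longleftrightarrow>
     ennreal (norm (F (t, \<phi>1) - F (t, \<phi>2)))
       \<le> ennreal L * (SUP \<theta>\<in>I. ennreal (norm (\<phi>1 \<theta> - \<phi>2 \<theta>)))"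

definition unif_loc_Lipschitz_about_C1_prolongations ::
  "real set \<Rightarrow> (real \<Rightarrow> 'e::real_normed_vector) topology \<Rightarrow> (real \<times> (real \<Rightarrow> 'e)) set
     \<Rightarrow> (real \<times> (real \<Rightarrow> 'e) \<Rightarrow> 'e) \<Rightarrow> bool" where
  "unif_loc_Lipschitz_about_C1_prolongations I H D F \<longleftrightarrow>
     (\<forall>p0\<in>D. \<exists>W0. nbhd (subtopology (prod_topology euclideanreal H) D) p0 W0 \<and>
        (\<exists>T>0. \<exists>\<delta>>0. \<exists>L>0.
           \<forall>(\<sigma>, \<psi>)\<in>W0. \<forall>t \<phi>1 \<phi>2.
             (t, \<phi>1) \<in> Lambda1 I \<sigma> \<psi> T \<delta> (F (\<sigma>, \<psi>)) \<inter> D \<longrightarrow>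
             (t, \<phi>2) \<in> Lambda1 I \<sigma> \<psi> T \<delta> (F (\<sigma>, \<psi>)) \<inter> D \<longrightarrow>
             compact (supp_on I (\<lambda>\<theta>. \<phi>1 \<theta> - \<phi>2 \<theta>)) \<longrightarrow>
             Lip_ineq I F L t \<phi>1 \<phi>2))"

section \<open>Solutions\<close>

definition is_solution ::
  "real set \<Rightarrow> (real \<times> (real \<Rightarrow> 'e::real_normed_vector)) set \<Rightarrow> (real \<times> (real \<Rightarrow> 'e) \<Rightarrow> 'e)
     \<Rightarrow> real \<Rightarrow> (real \<Rightarrow> 'e) \<Rightarrow> real set \<Rightarrow> (real \<Rightarrow> 'e) \<Rightarrow> bool" where
  "is_solution I D F t0 \<phi>0 J x \<longleftrightarrow>
     left_end_interval t0 J \<and> J \<noteq> {t0} \<and>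
     x \<in> Maps (J + I) \<and> seg I t0 x = \<phi>0 \<and>
     (\<forall>t\<in>J. (t, seg I t x) \<in> D \<and>
            (x has_vector_derivative F (t, seg I t x)) (at t within J))"

definition is_C1_solution ::
  "real set \<Rightarrow> (real \<times> (real \<Rightarrow> 'e::real_normed_vector)) set \<Rightarrow> (real \<times> (real \<Rightarrow> 'e) \<Rightarrow> 'e)
     \<Rightarrow> real \<Rightarrow> (real \<Rightarrow> 'e) \<Rightarrow> real set \<Rightarrow> (real \<Rightarrow> 'e) \<Rightarrow> bool" where
  "is_C1_solution I D F t0 \<phi>0 J x \<longleftrightarrow> is_solution I D F t0 \<phi>0 J x \<and> C1_on J x"

definition sol_le :: "real set \<Rightarrow> (real \<Rightarrow> 'e) \<Rightarrow> real set \<Rightarrow> (real \<Rightarrow> 'e) \<Rightarrow> bool" where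
  "sol_le J1 x1 J2 x2 \<longleftrightarrow> J1 \<subseteq> J2 \<and> (\<forall>t\<in>J1. x1 t = x2 t)"

definition is_maximal_C1_solution ::
  "real set \<Rightarrow> (real \<times> (real \<Rightarrow> 'e::real_normed_vector)) set \<Rightarrow> (real \<times> (real \<Rightarrow> 'e) \<Rightarrow> 'e)
     \<Rightarrow> real \<Rightarrow> (real \<Rightarrow> 'e) \<Rightarrow> real set \<Rightarrow> (real \<Rightarrow> 'e) \<Rightarrow> bool" where
  "is_maximal_C1_solution I D F t0 \<phi>0 J x \<longleftrightarrow>
     is_C1_solution I D F t0 \<phi>0 J x \<and>
     (\<forall>J' x'. is_C1_solution I D F t0 \<phi>0 J' x' \<and> sol_le J x J' x' \<longrightarrow> J' = J \<and> x' = x)"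

section \<open>Maximal semiflows and processes\<close>

definition maximal_semiflow ::
  "'a topology \<Rightarrow> (real \<times> 'a) set \<Rightarrow> (real \<times> 'a \<Rightarrow> 'a) \<Rightarrow> bool" where
  "maximal_semiflow X dm \<Phi> \<longleftrightarrow>
     \<Phi> ` dm \<subseteq> topspace X \<and>
     (\<exists>T :: 'a \<Rightarrow> ereal. (\<forall>x\<in>topspace X. 0 < T x) \<and>
        dm = (\<Union>x\<in>topspace X. {t. 0 \<le> t \<and> ereal t < T x} \<times> {x})) \<and>
     (\<forall>x\<in>topspace X. \<Phi> (0, x) = x) \<and>
     (\<forall>t1 t2 x. (t1, x) \<in> dm \<longrightarrow> (t2, \<Phi> (t1, x)) \<in> dm \<longrightarrow>
        (t1 + t2, x) \<in> dm \<and> \<Phi> (t1 + t2, x) = \<Phi> (t2, \<Phi> (t1, x)))"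

definition continuous_maximal_semiflow ::
  "'a topology \<Rightarrow> (real \<times> 'a) set \<Rightarrow> (real \<times> 'a \<Rightarrow> 'a) \<Rightarrow> bool" where
  "continuous_maximal_semiflow X dm \<Phi> \<longleftrightarrow>
     maximal_semiflow X dm \<Phi> \<and>
     openin (prod_topology (top_of_set {0..}) X) dm \<and>
     continuous_map (subtopology (prod_topology (top_of_set {0..}) X) dm) X \<Phi>"

definition continuous_maximal_process ::
  "'a topology \<Rightarrow> (real \<times> 'a) set \<Rightarrow> (real \<times> (real \<times> 'a)) set
     \<Rightarrow> (real \<times> (real \<times> 'a) \<Rightarrow> 'a) \<Rightarrow> bool" where
  "continuous_maximal_process X \<Omega> dm P \<longleftrightarrow>
     continuous_maximal_semiflow (subtopology (prod_topology euclideanreal X) \<Omega>) dm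
       (\<lambda>(\<tau>, t, x). (t + \<tau>, P (\<tau>, t, x)))"

definition maximally_well_posed_C1 ::
  "real set \<Rightarrow> (real \<Rightarrow> 'e::real_normed_vector) topology \<Rightarrow> (real \<times> (real \<Rightarrow> 'e)) set
     \<Rightarrow> (real \<times> (real \<Rightarrow> 'e) \<Rightarrow> 'e) \<Rightarrow> bool" where
  "maximally_well_posed_C1 I H D F \<longleftrightarrow>
     (\<exists>(TF :: real \<times> (real \<Rightarrow> 'e) \<Rightarrow> ereal) (xF :: real \<times> (real \<Rightarrow> 'e) \<Rightarrow> (real \<Rightarrow> 'e)).
        (\<forall>(t0, \<phi>0)\<in>D.
           0 < TF (t0, \<phi>0) \<and>
           (\<forall>J x. is_maximal_C1_solution I D F t0 \<phi>0 J x \<longleftrightarrow>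
              J = {t. t0 \<le> t \<and> ereal (t - t0) < TF (t0, \<phi>0)} \<and> x = xF (t0, \<phi>0))) \<and>
        continuous_maximal_process H D
          (\<Union>(t0, \<phi>0)\<in>D. {\<tau>. 0 \<le> \<tau> \<and> ereal \<tau> < TF (t0, \<phi>0)} \<times> {(t0, \<phi>0)})
          (\<lambda>(\<tau>, t0, \<phi>0). seg I (t0 + \<tau>) (xF (t0, \<phi>0))))"

end

theory Submission
  imports Defs
begin

text \<open>
  Near a datum \<open>p = (\<sigma>, \<psi>)\<close> the history equation is an ordinary fixed-point problem for the derivative of
  the unknown. A \<open>C\<^sup>1\<close> continuation of \<open>\<psi>\<close> with initial slope \<open>F p\<close> is
  \<open>\<psi> 0 + s F p + \<integral>\<^sub>0\<^sup>s u\<close> with \<open>u\<close> continuous and \<open>u 0 = 0\<close>, and it solves the equation iff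
  \<open>u s = F (\<sigma> + s, segment at s) - F p\<close>. On continuous \<open>u\<close> bounded by \<open>\<eta>\<close> on \<open>[0, T]\<close> the right-hand side
  is a contraction in the supremum norm: two continuations differ by an integral, hence by at most \<open>T\<close>
  times the distance of the \<open>u\<close>'s, and \<open>F\<close> is Lipschitz with respect to the supremum norm of that
  difference. Working with \<open>u\<close> rather than with the continuation makes the space complete and makes the
  \<open>C\<^sup>1\<close> bounds that occur in the rectangles by prolongations immediate.

  The delicate point is that the right-hand side must map the \<open>\<eta>\<close>-ball to itself for one pair \<open>T, \<eta>\<close>,
  uniformly for data near \<open>p\<close>. Regulation by prolongations alone does not give this, because the \<open>\<delta>\<close> that it
  provides depends on how close \<open>F\<close> has to stay to \<open>F p\<close>, that is, on \<open>\<eta>\<close> itself. Instead the Lipschitz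
  estimate compares an arbitrary \<open>u\<close> with \<open>u = 0\<close> at the price \<open>\<eta> / 2\<close>, and the affine continuation \<open>u = 0\<close> is
  controlled for small \<open>T\<close> by the continuity of \<open>(t, v, \<phi>) \<mapsto> S\<^sub>v(t)\<phi>\<close> (lemma \<open>ex_contraction_box\<close>).
  The fixed point depends continuously on the datum, by the tube lemma on the compact interval
  \<open>[0, T]\<close>, and regulation then turns uniform closeness of the \<open>u\<close>'s into closeness of the segments in \<open>H\<close>,
  uniformly in time. So the segments of the local solutions depend jointly continuously on time and
  datum (\<open>continuous_map_local_solution\<close>).

  The rest is the classical passage from local to global. Any solution starts inside a small ball, so
  the contraction gives local and then global uniqueness (\<open>solution_unique\<close>); solutions can be glued, so
  the union of all solutions is maximal and lives on a half-open interval
  (\<open>lifetimes_iff\<close>, \<open>maximal_C1_solution_iff\<close>); and a maximal semiflow with continuous orbits that is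
  jointly continuous for short times near every point is a continuous maximal semiflow
  (\<open>continuous_maximal_semiflowI\<close>).
\<close>

section \<open>Prolongations with prescribed derivative\<close>

definition primitive :: "(real \<Rightarrow> 'e::banach) \<Rightarrow> real \<Rightarrow> 'e" where
  "primitive u t = integral {0..t} u"

lemma primitive_nonpos: "t \<le> 0 \<Longrightarrow> primitive u t = 0"
  by (cases "t = 0") (auto simp: primitive_def)

lemma has_vector_derivative_primitive:
  assumes "continuous_on UNIV u" "s \<ge> 0"
  shows "(primitive u has_vector_derivative u s) (at s within {0..})"
proof -
  have "((\<lambda>t. integral {0..t} u) has_vector_derivative u s) (at s within {0..s+1})"
    using assms by (intro integral_has_vector_derivative continuous_on_subset[OF assms(1)]) auto
  moreover have "at s within {0..s+1} = at s within {0..}"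
    by (rule at_within_nhd[of _ "{..<s+1}"]) auto
  ultimately show ?thesis by (simp add: primitive_def[abs_def])
qed

lemma norm_primitive_le:
  assumes "continuous_on UNIV u" "\<And>s. 0 \<le> s \<Longrightarrow> s \<le> t \<Longrightarrow> norm (u s) \<le> \<eta>" "0 \<le> t"
  shows "norm (primitive u t) \<le> \<eta> * t"
  using integral_bound[of 0 t u \<eta>] assms continuous_on_subset[OF assms(1), of "{0..t}"]
  by (auto simp: primitive_def)

lemma primitive_diff:
  assumes "continuous_on UNIV u" "continuous_on UNIV w"
  shows "primitive (\<lambda>s. u s - w s) t = primitive u t - primitive w t"
  unfolding primitive_def
  by (intro integral_diff integrable_continuous_real continuous_on_subset[OF assms(1)]
        continuous_on_subset[OF assms(2)]) auto

text \<open>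
  Every \<open>C\<^sup>1\<close> continuation of \<open>\<psi>\<close> to \<open>[0, \<infinity>)\<close> with right derivative \<open>v\<close> at \<open>0\<close> has this form, with \<open>u\<close>
  its derivative minus \<open>v\<close>.
\<close>

definition prolong_by :: "(real \<Rightarrow> 'e::banach) \<Rightarrow> 'e \<Rightarrow> (real \<Rightarrow> 'e) \<Rightarrow> real \<Rightarrow> 'e" where
  "prolong_by \<psi> v u s = affine_prolong \<psi> v s + primitive u s"

lemma prolong_by_nonpos: "s \<le> 0 \<Longrightarrow> prolong_by \<psi> v u s = \<psi> s"
  by (auto simp: prolong_by_def primitive_nonpos affine_prolong_def)

lemma prolong_by_nonneg: "0 \<le> s \<Longrightarrow> prolong_by \<psi> v u s = \<psi> 0 + s *\<^sub>R v + primitive u s"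
  by (auto simp: prolong_by_def affine_prolong_def)

lemma has_vector_derivative_prolong_by:
  assumes "continuous_on UNIV u" "s \<ge> 0"
  shows "(prolong_by \<psi> v u has_vector_derivative v + u s) (at s within {0..})"
proof -
  have "((\<lambda>s. \<psi> 0 + s *\<^sub>R v) has_vector_derivative v) (at s within {0..})"
    by (auto intro!: derivative_eq_intros simp: has_vector_derivative_def)
  then have "((\<lambda>s. \<psi> 0 + s *\<^sub>R v + primitive u s) has_vector_derivative v + u s) (at s within {0..})"
    using has_vector_derivative_primitive[OF assms] by (rule has_vector_derivative_add)
  then show ?thesis
    by (rule has_vector_derivative_transform[rotated 2]) (use assms in \<open>auto simp: prolong_by_nonneg\<close>)
qed

lemma seg_in_Maps: "seg I t \<gamma> \<in> Maps I"
  by (auto simp: seg_def Maps_def)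

lemma seg_cong: "(\<And>\<theta>. \<theta> \<in> I \<Longrightarrow> x (t + \<theta>) = y (s + \<theta>)) \<Longrightarrow> seg I t x = seg I s y"
  by (auto simp: seg_def)

lemma seg_at_0: "0 \<in> I \<Longrightarrow> seg I t x 0 = x t"
  by (auto simp: seg_def)

lemma segD: "seg I t x = seg I s y \<Longrightarrow> \<theta> \<in> I \<Longrightarrow> x (t + \<theta>) = y (s + \<theta>)"
  by (auto simp: seg_def fun_eq_iff split: if_splits)

lemma seg_prolong_by:
  "seg I t (prolong_by \<psi> v u) = (\<lambda>\<theta>. S_shift I v t \<psi> \<theta> + seg I t (primitive u) \<theta>)"
  by (auto simp: seg_def prolong_by_def S_shift_def)

lemma past_interval_nonpos: "past_interval I \<Longrightarrow> \<theta> \<in> I \<Longrightarrow> \<theta> \<le> 0"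
  by (auto simp: past_interval_def)

lemma past_interval_0: "past_interval I \<Longrightarrow> 0 \<in> I"
  by (auto simp: past_interval_def)

lemma past_interval_between: "past_interval I \<Longrightarrow> \<theta> \<in> I \<Longrightarrow> \<theta> \<le> s \<Longrightarrow> s \<le> 0 \<Longrightarrow> s \<in> I"
  unfolding past_interval_def is_interval_1 by blast

lemma seg_0_prolong_by:
  assumes "past_interval I" "\<psi> \<in> Maps I"
  shows "seg I 0 (prolong_by \<psi> v u) = \<psi>"
  using assms by (auto simp: seg_def Maps_def prolong_by_nonpos past_interval_nonpos)

lemma C1_prolongation_prolong_by:
  assumes I: "past_interval I" and \<psi>: "\<psi> \<in> Maps I" and u: "continuous_on UNIV u"
  shows "C1_prolongation I 0 \<psi> {0..} (prolong_by \<psi> v u)"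
  unfolding C1_prolongation_def
proof (intro conjI)
  show "left_end_interval 0 {0::real..}" by (auto simp: left_end_interval_def is_interval_1)
  show "prolong_by \<psi> v u \<in> Maps ({0..} + I)"
    unfolding Maps_def
  proof (intro CollectI allI impI)
    fix t assume t: "t \<notin> {0..} + I"
    have "t \<notin> I" using t set_plus_intro[of 0 "{0..}" t I] by auto
    moreover have "t < 0" 
      using t set_plus_intro[of t "{0..}" 0 I] past_interval_0[OF I] by force
    ultimately show "prolong_by \<psi> v u t = 0" using \<psi> by (auto simp: prolong_by_nonpos Maps_def)
  qed
  show "seg I 0 (prolong_by \<psi> v u) = \<psi>" using I \<psi> by (rule seg_0_prolong_by)
  show "C1_on {0..} (prolong_by \<psi> v u)"
    unfolding C1_on_def
    using has_vector_derivative_prolong_by[OF u]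
    by (intro exI[of _ "\<lambda>s. v + u s"]) (auto intro!: continuous_intros continuous_on_subset[OF u])
qed

text \<open>
  The rectangles by prolongations enter the proof only through this membership: the \<open>C\<^sup>1\<close> distance to the
  affine continuation is at most \<open>T \<eta> + \<eta>\<close>, because that difference is the primitive of \<open>u\<close>.
\<close>

lemma prolong_by_in_Lambda1:
  assumes I: "past_interval I" and \<psi>: "\<psi> \<in> Maps I" and u: "continuous_on UNIV u" and u0: "u 0 = 0"
    and t: "0 \<le> t" "t \<le> T" and bd: "\<And>s. 0 \<le> s \<Longrightarrow> s \<le> t \<Longrightarrow> norm (u s) \<le> \<eta>"
    and \<delta>: "ennreal ((T + 1) * \<eta>) \<le> \<delta>"
  shows "(\<sigma> + t, seg I t (prolong_by \<psi> v u)) \<in> Lambda1 I \<sigma> \<psi> T \<delta> v"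
proof -
  have \<eta>: "\<eta> \<ge> 0" using bd[of 0] t u0 by auto
  have "\<exists>\<gamma>. seg I (\<sigma> + t) \<gamma> = seg I t (prolong_by \<psi> v u) \<and> \<gamma> \<in> Gamma1 I \<sigma> \<psi> t \<delta> v"
  proof (cases "t = 0")
    case True
    have "seg I \<sigma> (\<lambda>t. \<psi> (t - \<sigma>)) = seg I 0 (prolong_by \<psi> v u)"
      unfolding seg_0_prolong_by[OF I \<psi>] using \<psi> by (auto simp: seg_def Maps_def)
    with True show ?thesis by (auto simp: Gamma1_def)
  next
    case False
    define \<gamma> where "\<gamma> r = (if r \<in> {\<sigma>..\<sigma>+t} + I then prolong_by \<psi> v u (r - \<sigma>) else 0)" for r
    have inI: "s + \<theta> \<in> {\<sigma>..\<sigma>+t} + I" if "s \<in> {\<sigma>..\<sigma>+t}" "\<theta> \<in> I" for s \<theta>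
      using that by (rule set_plus_intro)
    have \<gamma>J: "\<gamma> s = prolong_by \<psi> v u (s - \<sigma>)" if "s \<in> {\<sigma>..\<sigma>+t}" for s
      using inI[OF that past_interval_0[OF I]] by (simp add: \<gamma>_def)
    have \<gamma>seg: "seg I s \<gamma> = seg I (s - \<sigma>) (prolong_by \<psi> v u)" if "s \<in> {\<sigma>..\<sigma>+t}" for s
      using inI[OF that] by (intro seg_cong) (auto simp: \<gamma>_def algebra_simps)
    have der: "(\<gamma> has_vector_derivative v + u (s - \<sigma>)) (at s within {\<sigma>..\<sigma>+t})"
      if s: "s \<in> {\<sigma>..\<sigma>+t}" for s
    proof -
      have "((\<lambda>s. prolong_by \<psi> v u (s - \<sigma>)) has_vector_derivative 1 *\<^sub>R (v + u (s - \<sigma>)))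
          (at s within {\<sigma>..\<sigma>+t})"
        using s
        by (intro vector_diff_chain_within[of "\<lambda>s. s - \<sigma>" 1 s _ "prolong_by \<psi> v u", unfolded o_def]
            has_vector_derivative_within_subset[OF has_vector_derivative_prolong_by[OF u]])
           (auto intro!: derivative_eq_intros)
      then show ?thesis
        by (intro has_vector_derivative_transform[OF s, of \<gamma>]) (auto simp: \<gamma>J)
    qed
    have "C1_prolongation I \<sigma> \<psi> {\<sigma>..\<sigma> + t} \<gamma>"
      unfolding C1_prolongation_def
    proof (intro conjI)
      show "left_end_interval \<sigma> {\<sigma>..\<sigma>+t}" using t by (auto simp: left_end_interval_def is_interval_1)
      show "\<gamma> \<in> Maps ({\<sigma>..\<sigma>+t} + I)" by (auto simp: Maps_def \<gamma>_def)
      show "seg I \<sigma> \<gamma> = \<psi>" using \<gamma>seg[of \<sigma>] t seg_0_prolong_by[OF I \<psi>] by auto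
      show "C1_on {\<sigma>..\<sigma>+t} \<gamma>" unfolding C1_on_def
        by (rule exI[of _ "\<lambda>s. v + u (s - \<sigma>)"])
           (use der in \<open>auto intro!: continuous_intros continuous_on_compose2[OF u]\<close>)
    qed
    moreover have "C1_norm t (\<lambda>s. \<gamma> (\<sigma> + s) - affine_prolong \<psi> v s) \<le> \<delta>"
    proof -
      have g: "\<gamma> (\<sigma> + s) - affine_prolong \<psi> v s = primitive u s" if "s \<in> {0..t}" for s
        using \<gamma>J[of "\<sigma> + s"] that by (auto simp: prolong_by_def)
      have g': "vector_derivative (\<lambda>s. \<gamma> (\<sigma> + s) - affine_prolong \<psi> v s) (at s within {0..t}) = u s"
        if s: "s \<in> {0..t}" for s
      proof (rule vector_derivative_within)
        show "at s within {0..t} \<noteq> bot" using s False t by (simp add: trivial_limit_within islimpt_Icc)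
        show "((\<lambda>s. \<gamma> (\<sigma> + s) - affine_prolong \<psi> v s) has_vector_derivative u s) (at s within {0..t})"
          by (rule has_vector_derivative_transform[OF s g])
             (use s in \<open>auto intro!: has_vector_derivative_within_subset[OF has_vector_derivative_primitive[OF u]]\<close>)
      qed
      have "(SUP s\<in>{0..t}. ennreal (norm (\<gamma> (\<sigma> + s) - affine_prolong \<psi> v s))) \<le> ennreal (T * \<eta>)"
      proof (rule SUP_least)
        fix s assume s: "s \<in> {0..t}"
        have "norm (primitive u s) \<le> \<eta> * s" using s bd by (intro norm_primitive_le u) auto
        also have "\<dots> \<le> T * \<eta>" using s t \<eta> by (subst mult.commute) (auto intro!: mult_right_mono)
        finally show "ennreal (norm (\<gamma> (\<sigma> + s) - affine_prolong \<psi> v s)) \<le> ennreal (T * \<eta>)"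
          unfolding g[OF s] by (rule ennreal_leI)
      qed
      moreover have "(SUP s\<in>{0..t}. ennreal (norm (vector_derivative
            (\<lambda>s. \<gamma> (\<sigma> + s) - affine_prolong \<psi> v s) (at s within {0..t})))) \<le> ennreal \<eta>"
        by (rule SUP_least) (use bd in \<open>auto simp: g' intro!: ennreal_leI\<close>)
      ultimately have "C1_norm t (\<lambda>s. \<gamma> (\<sigma> + s) - affine_prolong \<psi> v s) \<le> ennreal (T * \<eta>) + ennreal \<eta>"
        unfolding C1_norm_def by (rule add_mono)
      also have "\<dots> = ennreal ((T + 1) * \<eta>)"
        using \<eta> t by (simp add: ennreal_plus[symmetric] algebra_simps del: ennreal_plus)
      finally show ?thesis using \<delta> by (rule order_trans)
    qed
    moreover have "(\<gamma> has_vector_derivative v) (at \<sigma> within {\<sigma>..\<sigma> + t})"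
      using der[of \<sigma>] t u0 by auto
    ultimately have "\<gamma> \<in> Gamma1 I \<sigma> \<psi> t \<delta> v" using False by (auto simp: Gamma1_def)
    moreover have "seg I (\<sigma> + t) \<gamma> = seg I t (prolong_by \<psi> v u)" using \<gamma>seg[of "\<sigma> + t"] t by auto
    ultimately show ?thesis by blast
  qed
  then obtain \<gamma> where "seg I t (prolong_by \<psi> v u) = seg I (\<sigma> + t) \<gamma>" "\<gamma> \<in> Gamma1 I \<sigma> \<psi> t \<delta> v"
    by metis
  then show ?thesis unfolding Lambda1_def using t
    by (intro UN_I[of t] CollectI exI[of _ \<gamma>] conjI) auto
qed

section \<open>Continuity of maximal semiflows from local data\<close>

lemma prod_topology_top_of_set_left:
  "prod_topology (top_of_set S) X = subtopology (prod_topology euclidean X) (S \<times> UNIV)"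
  by (simp add: subtopology_Times)

text \<open>
  For a fixed \<open>x\<close>, the times \<open>t\<close> for which the semiflow is defined and continuous on \<open>[0, t] \<times> U\<close> for some
  neighborhood \<open>U\<close> of \<open>x\<close> form an interval. It cannot end at a time \<open>s\<^sub>1\<close> of the life of \<open>x\<close>: the point
  reached at \<open>s\<^sub>1\<close> has a neighborhood with a uniform continuity time \<open>T\<close>, and by continuity of the orbit
  that neighborhood is already entered at some time before \<open>s\<^sub>1\<close> from which \<open>T\<close> leads beyond \<open>s\<^sub>1\<close>.
\<close>

lemma continuous_maximal_semiflowI:
  assumes sf: "maximal_semiflow X dm \<Phi>"
    and orbit: "\<And>x t. (t, x) \<in> dm \<Longrightarrow> continuous_map (top_of_set {0..t}) X (\<lambda>s. \<Phi> (s, x))"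
    and local: "\<And>x. x \<in> topspace X \<Longrightarrow> \<exists>T>0. \<exists>U. openin X U \<and> x \<in> U \<and> {0..T} \<times> U \<subseteq> dm \<and>
      continuous_map (subtopology (prod_topology euclidean X) ({0..T} \<times> U)) X \<Phi>"
  shows "continuous_maximal_semiflow X dm \<Phi>"
proof -
  let ?C = "\<lambda>S. continuous_map (subtopology (prod_topology euclideanreal X) S) X \<Phi>"
  define good where "good x t \<longleftrightarrow> t \<ge> 0 \<and> (\<exists>U. openin X U \<and> x \<in> U \<and> {0..t} \<times> U \<subseteq> dm \<and> ?C ({0..t} \<times> U))"
    for x t
  from sf obtain T where dm: "dm = (\<Union>x\<in>topspace X. {t. 0 \<le> t \<and> ereal t < T x} \<times> {x})"
    and \<Phi>X: "\<Phi> ` dm \<subseteq> topspace X"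
    and add: "\<And>t1 t2 x. (t1, x) \<in> dm \<Longrightarrow> (t2, \<Phi> (t1, x)) \<in> dm \<Longrightarrow>
        (t1 + t2, x) \<in> dm \<and> \<Phi> (t1 + t2, x) = \<Phi> (t2, \<Phi> (t1, x))"
    unfolding maximal_semiflow_def by blast
  have dm_down: "(s, x) \<in> dm" if "(t, x) \<in> dm" "0 \<le> s" "s \<le> t" for s t x
    using that by (auto simp: dm intro: le_less_trans[of "ereal s" "ereal t"])
  have dm_top: "x \<in> topspace X \<and> 0 \<le> t" if "(t, x) \<in> dm" for t x
    using that by (auto simp: dm)
  have good_mono: "good x s" if g: "good x t" "0 \<le> s" "s \<le> t" for x s t
  proof -
    obtain U where U: "openin X U" "x \<in> U" "{0..t} \<times> U \<subseteq> dm" "?C ({0..t} \<times> U)"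
      using g by (auto simp: good_def)
    have sub: "{0..s} \<times> U \<subseteq> {0..t} \<times> U" using that by auto
    then have "?C ({0..s} \<times> U)" using U(4) continuous_map_from_subtopology_mono by blast
    with U sub that show ?thesis unfolding good_def by blast
  qed
  have step: "good x (s + T)"
    if g: "good x s" and T: "T \<ge> 0" and W: "openin X W" "\<Phi> (s, x) \<in> W" "{0..T} \<times> W \<subseteq> dm" "?C ({0..T} \<times> W)"
    for x s T W
  proof -
    obtain U where U: "openin X U" "x \<in> U" "{0..s} \<times> U \<subseteq> dm" "?C ({0..s} \<times> U)" and s: "s \<ge> 0"
      using g by (auto simp: good_def)
    have UX: "U \<subseteq> topspace X" using U(1) by (rule openin_subset)
    have cs: "continuous_map (subtopology X U) X (\<lambda>y. \<Phi> (s, y))"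
      by (rule continuous_map_compose[OF _ U(4), unfolded o_def])
         (use s in \<open>auto simp: continuous_map_in_subtopology intro!: continuous_map_pairedI
            continuous_map_from_subtopology[OF continuous_map_id[unfolded id_def]]\<close>)
    define U' where "U' = {y \<in> U. \<Phi> (s, y) \<in> W}"
    have U'D: "y \<in> U \<and> \<Phi> (s, y) \<in> W" if "y \<in> U'" for y using that by (simp add: U'_def)
    have "openin (subtopology X U) U'"
      using openin_continuous_map_preimage[OF cs W(1)] UX by (simp add: U'_def Int_absorb1)
    then have U': "openin X U'" using U(1) openin_trans_full by blast
    \<comment> \<open>After time \<open>s\<close> the semiflow on \<open>U'\<close> factors through the box around \<open>\<Phi> (s, x)\<close>.\<close>
    have late: "(r, y) \<in> dm \<and> \<Phi> (r, y) = \<Phi> (r - s, \<Phi> (s, y))"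
      if "y \<in> U'" "s \<le> r" "r \<le> s + T" for r y
    proof -
      have "(s, y) \<in> dm" using that U(3) s by (auto simp: U'_def)
      moreover have "(r - s, \<Phi> (s, y)) \<in> dm" using that W(3) by (auto simp: U'_def)
      ultimately show ?thesis using add[of s y "r - s"] by simp
    qed
    have dm': "{0..s + T} \<times> U' \<subseteq> dm"
    proof clarify
      fix r y assume "r \<in> {0..s + T}" "y \<in> U'"
      then show "(r, y) \<in> dm" using late[of y r] U(3) by (cases "s \<le> r") (auto simp: U'_def)
    qed
    let ?Z = "subtopology (prod_topology euclideanreal X) ({0..s + T} \<times> U')"
    have fstc: "continuous_map (subtopology ?Z A) euclideanreal fst" for A
      by (intro continuous_map_from_subtopology continuous_map_fst)
    have sndc: "continuous_map (subtopology ?Z A) X snd" for A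
      by (intro continuous_map_from_subtopology continuous_map_snd)
    have "continuous_map ?Z X (\<lambda>z. if fst z \<le> s then \<Phi> z else \<Phi> (fst z - s, \<Phi> (s, snd z)))"
    proof (rule continuous_map_cases_le)
      show "continuous_map ?Z euclideanreal fst" "continuous_map ?Z euclideanreal (\<lambda>_. s)"
        by (auto intro!: continuous_map_from_subtopology continuous_map_fst)
      show "continuous_map (subtopology ?Z {x \<in> topspace ?Z. fst x \<le> s}) X \<Phi>"
        unfolding subtopology_subtopology
        by (rule continuous_map_from_subtopology_mono[OF U(4)]) (auto simp: U'_def)
      show "continuous_map (subtopology ?Z {x \<in> topspace ?Z. s \<le> fst x}) X (\<lambda>z. \<Phi> (fst z - s, \<Phi> (s, snd z)))"
        by (rule continuous_map_compose[OF _ W(4), unfolded o_def])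
           (auto simp: continuous_map_in_subtopology dest!: U'D intro!: continuous_map_pairedI
              continuous_map_diff fstc sndc continuous_map_compose[OF _ cs, unfolded o_def])
      show "\<Phi> z = \<Phi> (fst z - s, \<Phi> (s, snd z))" if "z \<in> topspace ?Z" "fst z = s" for z
        using that late[of "snd z" s] T by (cases z) auto
    qed
    then have "?C ({0..s + T} \<times> U')"
    proof (rule continuous_map_eq)
      fix z assume "z \<in> topspace ?Z"
      then show "(if fst z \<le> s then \<Phi> z else \<Phi> (fst z - s, \<Phi> (s, snd z))) = \<Phi> z"
        using late[of "snd z" "fst z"] by (cases z) simp
    qed
    moreover have "x \<in> U'" using U W by (simp add: U'_def)
    ultimately show ?thesis using U' dm' s T unfolding good_def by auto
  qed
  have good_ge: "good x t" if tx: "(t, x) \<in> dm" for t x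
  proof -
    have xX: "x \<in> topspace X" and t: "0 \<le> t" using dm_top[OF tx] by auto
    define S where "S = {s \<in> {0..t}. good x s}"
    define s1 where "s1 = Sup S"
    obtain T0 U0 where "T0 > 0" "openin X U0" "x \<in> U0" "{0..T0} \<times> U0 \<subseteq> dm" "?C ({0..T0} \<times> U0)"
      using local[OF xX] by blast
    then have "good x T0" "0 \<le> T0" unfolding good_def by auto
    then have "good x 0" using good_mono by blast
    then have S0: "0 \<in> S" using t by (simp add: S_def)
    have bdd: "bdd_above S" by (rule bdd_aboveI[of _ t]) (simp add: S_def)
    have s1: "0 \<le> s1" "s1 \<le> t"
    proof -
      show "0 \<le> s1" unfolding s1_def using S0 bdd by (rule cSup_upper)
      show "s1 \<le> t" unfolding s1_def by (rule cSup_least) (use S0 in \<open>auto simp: S_def\<close>)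
    qed
    then have s1dm: "(s1, x) \<in> dm" by (rule dm_down[OF tx])
    with \<Phi>X have "\<Phi> (s1, x) \<in> topspace X" by (simp add: image_subset_iff)
    from local[OF this] obtain T W where T: "T > 0" and W: "openin X W" "\<Phi> (s1, x) \<in> W"
        "{0..T} \<times> W \<subseteq> dm" "?C ({0..T} \<times> W)" by blast
    have "openin (top_of_set {0..s1}) {s \<in> {0..s1}. \<Phi> (s, x) \<in> W}"
      using openin_continuous_map_preimage[OF orbit[OF s1dm] W(1)] by simp
    moreover have "s1 \<in> {s \<in> {0..s1}. \<Phi> (s, x) \<in> W}" using W(2) s1 by simp
    ultimately obtain e where "e > 0" "\<forall>s\<in>{0..s1}. dist s s1 < e \<longrightarrow> s \<in> {s \<in> {0..s1}. \<Phi> (s, x) \<in> W}"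
      unfolding openin_euclidean_subtopology_iff by meson
    then have e: "e > 0" "\<And>s. s \<in> {0..s1} \<Longrightarrow> dist s s1 < e \<Longrightarrow> \<Phi> (s, x) \<in> W" by auto
    \<comment> \<open>Being within \<open>e\<close> of \<open>s1\<close> puts the orbit into \<open>W\<close>, being within \<open>T\<close> lets the box reach beyond \<open>s1\<close>.\<close>
    have "s1 - min e T < Sup S" unfolding s1_def[symmetric] using e(1) T by simp
    then obtain s where s: "s \<in> S" "s1 - min e T < s"
      using S0 less_cSupD[of S "s1 - min e T"] by blast
    moreover have "s \<le> s1" unfolding s1_def using s(1) bdd by (rule cSup_upper)
    ultimately have "\<Phi> (s, x) \<in> W" using e(2)[of s] by (auto simp: S_def dist_real_def)
    then have g: "good x (s + T)" using s T W by (intro step[of x s T W]) (auto simp: S_def)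
    show ?thesis
    proof (cases "t \<le> s + T")
      case True
      then show ?thesis using good_mono[OF g t] by simp
    next
      case False
      then have "s + T \<in> S" using g s T by (auto simp: S_def)
      then have "s + T \<le> s1" unfolding s1_def using bdd by (rule cSup_upper)
      then show ?thesis using s(2) by auto
    qed
  qed
  have box: "\<exists>t1>t. \<exists>U. openin X U \<and> x \<in> U \<and> {0..<t1} \<times> U \<subseteq> dm \<and> ?C ({0..<t1} \<times> U)"
    if tx: "(t, x) \<in> dm" for t x
  proof -
    have "\<Phi> (t, x) \<in> topspace X" using \<Phi>X tx by (simp add: image_subset_iff)
    from local[OF this] obtain T W where T: "T > 0" and W: "openin X W" "\<Phi> (t, x) \<in> W"
        "{0..T} \<times> W \<subseteq> dm" "?C ({0..T} \<times> W)" by blast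
    from step[OF good_ge[OF tx] _ W] T have "good x (t + T)" by simp
    then obtain U where U: "openin X U" "x \<in> U" "{0..t+T} \<times> U \<subseteq> dm" "?C ({0..t+T} \<times> U)"
      by (auto simp: good_def)
    have sub: "{0..<t+T} \<times> U \<subseteq> {0..t+T} \<times> U" by auto
    then have "?C ({0..<t+T} \<times> U)" using U(4) continuous_map_from_subtopology_mono by blast
    then show ?thesis using U sub T by (intro exI[of _ "t+T"]) auto
  qed
  let ?Y = "prod_topology (top_of_set {0::real..}) X"
  have opbox: "openin ?Y ({0..<t1} \<times> U)" if "openin X U" for t1 U
  proof -
    have "openin (top_of_set {0..}) ({0..<t1}::real set)"
      unfolding openin_open by (intro exI[of _ "{..<t1}"]) auto
    then show ?thesis using that by (simp add: openin_prod_Times_iff)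
  qed
  have open_dm: "openin ?Y dm"
  proof (subst openin_subopen, clarify)
    fix t x assume tx: "(t, x) \<in> dm"
    from box[OF this] obtain t1 U where U: "t1 > t" "openin X U" "x \<in> U" "{0..<t1} \<times> U \<subseteq> dm" by blast
    then show "\<exists>B. openin ?Y B \<and> (t, x) \<in> B \<and> B \<subseteq> dm"
      using dm_top[OF tx] opbox[OF U(2), of t1] by (intro exI[of _ "{0..<t1} \<times> U"]) auto
  qed
  have "continuous_map (subtopology ?Y dm) X \<Phi>"
  proof -
    from box have "\<forall>z\<in>dm. \<exists>t1 U. fst z < t1 \<and> openin X U \<and> snd z \<in> U \<and> {0..<t1} \<times> U \<subseteq> dm \<and> ?C ({0..<t1} \<times> U)"
      by auto
    then obtain t1 U where U: "\<And>z. z \<in> dm \<Longrightarrow> fst z < t1 z \<and> openin X (U z) \<and> snd z \<in> U z \<and>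
        {0..<t1 z} \<times> U z \<subseteq> dm \<and> ?C ({0..<t1 z} \<times> U z)" by metis
    show ?thesis
    proof (rule pasting_lemma[where I = dm and T = "\<lambda>z. {0..<t1 z} \<times> U z" and f = "\<lambda>_. \<Phi>"])
      fix z assume z: "z \<in> dm"
      show "openin (subtopology ?Y dm) ({0..<t1 z} \<times> U z)"
        using U[OF z] opbox by (simp add: openin_open_subtopology[OF open_dm])
      show "continuous_map (subtopology (subtopology ?Y dm) ({0..<t1 z} \<times> U z)) X \<Phi>"
        unfolding prod_topology_top_of_set_left subtopology_subtopology
        by (rule continuous_map_from_subtopology_mono[of _ "{0..<t1 z} \<times> U z"]) (use U[OF z] in auto)
    next
      fix z assume "z \<in> topspace (subtopology ?Y dm)"
      then have z: "z \<in> dm" by simp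
      then show "\<exists>j. j \<in> dm \<and> z \<in> {0..<t1 j} \<times> U j \<and> \<Phi> z = \<Phi> z"
        using U[OF z] dm_top by (intro exI[of _ z]) (cases z, auto)
    qed auto
  qed
  with open_dm sf show ?thesis unfolding continuous_maximal_semiflow_def by blast
qed

section \<open>The contraction estimate\<close>

lemma ennreal_scaled_below:
  assumes "(\<delta>::ennreal) > 0" "(c::real) > 0"
  shows "\<exists>e>0. ennreal (c * e) \<le> \<delta>"
proof (cases \<delta>)
  case (real d)
  then have "ennreal (c * (d / c)) \<le> \<delta>" "d / c > 0" using assms by auto
  then show ?thesis by blast
next
  case top
  then show ?thesis by (auto intro!: exI[of _ 1])
qed

text \<open>
  The Lipschitz condition compares only maps whose difference has compact support in \<open>I\<close>. Two
  continuations of the same history, seen at time \<open>t\<close>, differ only on \<open>[-t, 0]\<close>, which is a compact part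
  of \<open>I\<close> as long as \<open>-t\<close> belongs to \<open>I\<close>. For later times the support need not be compact if \<open>I\<close> is
  half-open, so \<open>r\<close> bounds the time step.
\<close>

lemma past_interval_compact_supp:
  assumes I: "past_interval I"
  shows "\<exists>r>0. \<forall>t\<in>{0..r}. \<forall>f. (\<forall>\<theta>\<in>I. \<theta> < -t \<longrightarrow> f \<theta> = 0) \<longrightarrow> compact (supp_on I f)"
proof (cases "I = {0}")
  case True
  then have "supp_on I f \<subseteq> {0}" for f
    using closure_of_subset_topspace[of "top_of_set I"] by (auto simp: supp_on_def)
  then have "compact (supp_on I f)" for f by (rule finite_imp_compact[OF finite_subset]) auto
  then show ?thesis by (intro exI[of _ 1]) auto
next
  case False
  then obtain r where r: "- r \<in> I" "r > 0"
    using past_interval_0[OF I] past_interval_nonpos[OF I]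
    by (metis add.inverse_inverse antisym_conv2 insertI1 neg_less_0_iff_less order_le_less singletonD subsetI subset_singletonD empty_iff)
  have "compact (supp_on I f)" if t: "t \<in> {0..r}" and f: "\<forall>\<theta>\<in>I. \<theta> < -t \<longrightarrow> f \<theta> = 0" for t f
  proof -
    let ?S = "{\<theta> \<in> I. f \<theta> \<noteq> 0}"
    have "{-t..0} \<subseteq> I" using past_interval_between[OF I r(1)] t by auto
    moreover have cl: "closure ?S \<subseteq> {-t..0}"
      by (rule closure_minimal) (use f past_interval_nonpos[OF I] in \<open>force+\<close>)
    ultimately have "supp_on I f = closure ?S"
      unfolding supp_on_def closure_of_subtopology by (auto simp: Int_def Collect_conj_eq[symmetric])
    then show ?thesis using cl by (auto simp: compact_eq_bounded_closed intro: bounded_subset[OF bounded_closed_interval])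
  qed
  then show ?thesis using r by blast
qed

locale history_ivp =
  fixes I :: "real set"
    and H :: "(real \<Rightarrow> 'e::banach) topology"
    and D :: "(real \<times> (real \<Rightarrow> 'e)) set"
    and F :: "real \<times> (real \<Rightarrow> 'e) \<Rightarrow> 'e"
  assumes past: "past_interval I"
    and history: "history_space I H"
    and D_subset: "D \<subseteq> UNIV \<times> topspace H"
    and prolongable: "C1_prolongable I H"
    and regulated: "regulated_by_C1_prolongations I H"
    and F_continuous: "continuous_map (subtopology (prod_topology euclideanreal H) D) euclidean F"
    and D_uniform: "\<forall>p0\<in>D. uniform_nbhd_by_C1_prolongations I H D p0"
    and F_Lipschitz: "unif_loc_Lipschitz_about_C1_prolongations I H D F"
    and S_continuous: "continuous_map (prod_topology (top_of_set {0..}) (prod_topology euclidean H)) H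
           (\<lambda>(t, v, \<phi>). S_shift I v t \<phi>)"
begin

abbreviation "RH \<equiv> prod_topology euclideanreal H"

abbreviation "phase \<equiv> subtopology RH D"

lemma topspace_phase: "topspace phase = D"
  using D_subset by auto

lemma H_Maps: "\<phi> \<in> topspace H \<Longrightarrow> \<phi> \<in> Maps I"
  using history by (auto simp: history_space_def)

lemma zero_in_H: "(\<lambda>_. 0) \<in> topspace H"
  using history by (auto simp: history_space_def)

lemma D_H: "p \<in> D \<Longrightarrow> snd p \<in> topspace H"
  using D_subset by auto

lemma continuous_map_H_add:
  assumes "continuous_map Z H f" "continuous_map Z H g"
  shows "continuous_map Z H (\<lambda>z. (\<lambda>\<theta>. f z \<theta> + g z \<theta>))"
proof -
  have "continuous_map (prod_topology H H) H (\<lambda>(\<phi>, \<psi>). (\<lambda>\<theta>. \<phi> \<theta> + \<psi> \<theta>))"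
    using history by (simp add: history_space_def)
  from continuous_map_compose[OF continuous_map_pairedI[OF assms] this] show ?thesis
    by (simp add: o_def)
qed

lemma continuous_map_S_shift:
  assumes "continuous_map Z (top_of_set {0..}) t" "continuous_map Z euclidean v" "continuous_map Z H \<phi>"
  shows "continuous_map Z H (\<lambda>z. S_shift I (v z) (t z) (\<phi> z))"
  using continuous_map_compose[OF continuous_map_pairedI[OF assms(1) continuous_map_pairedI[OF assms(2,3)]]
      S_continuous] by (simp add: o_def)

lemma continuous_map_seg_prolong_by:
  assumes "\<psi> \<in> topspace H" "continuous_on UNIV u"
  shows "continuous_map (top_of_set {0..}) H (\<lambda>t. seg I t (prolong_by \<psi> v u))"
  using prolongable assms C1_prolongation_prolong_by[OF past H_Maps]
  unfolding C1_prolongable_def by blast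

lemma prolong_by_zero: "prolong_by (\<lambda>_. 0) 0 u = primitive u"
  by (auto simp: prolong_by_def affine_prolong_def)

lemma continuous_map_seg_primitive:
  assumes "continuous_on UNIV u"
  shows "continuous_map (top_of_set {0..}) H (\<lambda>t. seg I t (primitive u))"
  using continuous_map_seg_prolong_by[OF zero_in_H assms, of 0] by (simp add: prolong_by_zero)

text \<open>
  Regulation by prolongations as a statement about primitives: a small derivative on \<open>[0, T]\<close> forces
  all segments up to time \<open>T\<close> to be close to zero in \<open>H\<close>.
\<close>

lemma seg_primitive_small:
  assumes N: "openin H N" "(\<lambda>_. 0) \<in> N" and T: "T > 0"
  shows "\<exists>e>0. \<forall>u t. continuous_on UNIV u \<longrightarrow> u 0 = 0 \<longrightarrow> (\<forall>s\<in>{0..t}. norm (u s) \<le> e) \<longrightarrow> t \<in> {0..T} \<longrightarrow>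
    seg I t (primitive u) \<in> N"
proof -
  have "nbhd H (\<lambda>_. 0) N" using N by (simp add: nbhd_def interior_of_openin openin_subset)
  then obtain \<delta> where \<delta>: "\<delta> > 0" "Lambda1 I 0 (\<lambda>_. 0) T \<delta> (0::'e) \<subseteq> {0..T} \<times> N"
    using regulated T unfolding regulated_by_C1_prolongations_def by blast
  obtain e where e: "e > 0" "ennreal ((T + 1) * e) \<le> \<delta>"
    using ennreal_scaled_below[OF \<delta>(1), of "T + 1"] T by auto
  have "seg I t (primitive u) \<in> N"
    if "continuous_on UNIV u" "u 0 = 0" "\<forall>s\<in>{0..t}. norm (u s) \<le> e" "t \<in> {0..T}" for u t
    using prolong_by_in_Lambda1[OF past H_Maps[OF zero_in_H] that(1,2), of t T e \<delta> 0 0] that e \<delta>(2)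
    by (auto simp: prolong_by_zero)
  with e(1) show ?thesis by blast
qed

text \<open>
  The point of \<open>\<real> \<times> H\<close> that is reached from \<open>p\<close> after time \<open>t\<close> along the continuation with derivative
  \<open>F p + u\<close>. A solution starting at \<open>p\<close> is a continuation with \<open>u s = F (future p u s) - F p\<close>.
\<close>

definition future :: "real \<times> (real \<Rightarrow> 'e) \<Rightarrow> (real \<Rightarrow> 'e) \<Rightarrow> real \<Rightarrow> real \<times> (real \<Rightarrow> 'e)" where
  "future p u t = (fst p + t, seg I t (prolong_by (snd p) (F p) u))"

lemma future_0: "p \<in> D \<Longrightarrow> future p u 0 = p"
  using seg_0_prolong_by[OF past H_Maps[OF D_H]] by (simp add: future_def)

definition control :: "real \<Rightarrow> real \<Rightarrow> (real \<Rightarrow> 'e) \<Rightarrow> bool" where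
  "control T \<eta> u \<longleftrightarrow> continuous_on UNIV u \<and> u 0 = 0 \<and> (\<forall>s\<in>{0..T}. norm (u s) \<le> \<eta>)"

lemma control_mono: "control T \<eta> u \<Longrightarrow> t \<le> T \<Longrightarrow> control t \<eta> u"
  by (auto simp: control_def)

lemma future_in_Lambda1:
  assumes "p \<in> D" "control t \<eta> u" "0 \<le> t" "t \<le> T" "ennreal ((T + 1) * \<eta>) \<le> \<delta>"
  shows "future p u t \<in> Lambda1 I (fst p) (snd p) T \<delta> (F p)"
  unfolding future_def using assms
  by (intro prolong_by_in_Lambda1[OF past H_Maps[OF D_H]]) (auto simp: control_def)

lemma future_Lip:
  assumes p: "p \<in> D" and u: "continuous_on UNIV u" and w: "continuous_on UNIV w"
    and t: "0 \<le> t" and M: "\<forall>s\<in>{0..t}. norm (u s - w s) \<le> M" and L: "L \<ge> 0"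
    and Lip: "Lip_ineq I F L (fst p + t) (snd (future p u t)) (snd (future p w t))"
  shows "norm (F (future p u t) - F (future p w t)) \<le> L * (M * t)"
proof -
  have M0: "M \<ge> 0" using M t norm_ge_zero order_trans by (metis atLeastAtMost_iff order_refl)
  have "(SUP \<theta>\<in>I. ennreal (norm (snd (future p u t) \<theta> - snd (future p w t) \<theta>))) \<le> ennreal (M * t)"
  proof (rule SUP_least)
    fix \<theta> assume \<theta>: "\<theta> \<in> I"
    have "snd (future p u t) \<theta> - snd (future p w t) \<theta> = primitive (\<lambda>s. u s - w s) (t + \<theta>)"
      using \<theta> by (simp add: future_def seg_def prolong_by_def primitive_diff[OF u w])
    moreover have "norm (primitive (\<lambda>s. u s - w s) (t + \<theta>)) \<le> M * t"
    proof (cases "t + \<theta> \<ge> 0")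
      case True
      then have "norm (primitive (\<lambda>s. u s - w s) (t + \<theta>)) \<le> M * (t + \<theta>)"
        using M past_interval_nonpos[OF past \<theta>]
        by (intro norm_primitive_le continuous_on_diff u w) auto
      also have "\<dots> \<le> M * t" using M0 past_interval_nonpos[OF past \<theta>] by (intro mult_left_mono) auto
      finally show ?thesis .
    next
      case False
      then show ?thesis using M0 t by (simp add: primitive_nonpos)
    qed
    ultimately show "ennreal (norm (snd (future p u t) \<theta> - snd (future p w t) \<theta>)) \<le> ennreal (M * t)"
      by (simp add: ennreal_leI)
  qed
  then have "ennreal L * (SUP \<theta>\<in>I. ennreal (norm (snd (future p u t) \<theta> - snd (future p w t) \<theta>)))
      \<le> ennreal L * ennreal (M * t)"
    by (rule mult_left_mono) simp
  with Lip[unfolded Lip_ineq_def]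
  have "ennreal (norm (F (fst p + t, snd (future p u t)) - F (fst p + t, snd (future p w t))))
      \<le> ennreal L * ennreal (M * t)"
    by (rule order_trans)
  moreover have "(fst p + t, snd (future p u t)) = future p u t" for u by (simp add: future_def)
  ultimately have "ennreal (norm (F (future p u t) - F (future p w t))) \<le> ennreal L * ennreal (M * t)"
    by simp
  then show ?thesis using L M0 t by (simp add: ennreal_mult'[symmetric])
qed

text \<open>
  The segment splits into \<open>S\<^sub>v(t)\<psi>\<close> with \<open>v = F p\<close>, which is jointly continuous by hypothesis, and the
  segment of the primitive of \<open>u\<close>, which depends on \<open>t\<close> alone.
\<close>

lemma continuous_map_future:
  assumes W: "W \<subseteq> D" and u: "continuous_on UNIV u"
    and D: "\<And>t p. t \<in> {0..T} \<Longrightarrow> p \<in> W \<Longrightarrow> future p u t \<in> D"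
  shows "continuous_map (prod_topology (top_of_set {0..T}) (subtopology RH W)) phase (\<lambda>z. future (snd z) u (fst z))"
proof -
  let ?Z = "prod_topology (top_of_set {0..T}) (subtopology RH W)"
  have WH: "topspace (subtopology RH W) = W" using W D_subset by auto
  have t: "continuous_map ?Z (top_of_set {0..T}) fst" and p: "continuous_map ?Z (subtopology RH W) snd"
    by (rule continuous_map_fst continuous_map_snd)+
  have t': "continuous_map ?Z euclideanreal fst" and t'': "continuous_map ?Z (top_of_set {0..}) fst"
    using t by (auto simp: continuous_map_in_subtopology Pi_iff)
  have p': "continuous_map ?Z RH snd" using p by (simp add: continuous_map_in_subtopology)
  have fp: "continuous_map ?Z euclideanreal (\<lambda>z. fst (snd z))" and sp: "continuous_map ?Z H (\<lambda>z. snd (snd z))"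
    using p' by (auto simp: continuous_map_pairwise o_def)
  have Fp: "continuous_map ?Z euclidean (\<lambda>z. F (snd z))"
    by (rule continuous_map_compose[OF _ F_continuous, unfolded o_def])
       (use p W in \<open>auto simp: continuous_map_in_subtopology Pi_iff\<close>)
  have "continuous_map ?Z H (\<lambda>z. seg I (fst z) (prolong_by (snd (snd z)) (F (snd z)) u))"
    unfolding seg_prolong_by
    by (intro continuous_map_H_add continuous_map_S_shift t'' Fp sp
        continuous_map_compose[OF t'' continuous_map_seg_primitive[OF u], unfolded o_def])
  then have "continuous_map ?Z RH (\<lambda>z. future (snd z) u (fst z))"
    unfolding future_def by (intro continuous_map_pairedI continuous_map_add fp t')
  then show ?thesis using D WH by (auto simp: continuous_map_in_subtopology)
qed

text \<open>
  On such a box the map \<open>u \<mapsto> F (future p u) - F p\<close> sends controls to controls and contracts by \<open>1 / 2\<close>,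
  with the same \<open>T\<close> and \<open>\<eta>\<close> for all data \<open>p\<close> in \<open>W\<close>.
\<close>

definition contraction_box :: "real \<Rightarrow> real \<Rightarrow> (real \<times> (real \<Rightarrow> 'e)) set \<Rightarrow> bool" where
  "contraction_box T \<eta> W \<longleftrightarrow> T > 0 \<and> \<eta> > 0 \<and> openin phase W \<and>
     (\<forall>p\<in>W. \<forall>u. control T \<eta> u \<longrightarrow> (\<forall>t\<in>{0..T}. future p u t \<in> D \<and> norm (F (future p u t) - F p) \<le> \<eta>)) \<and>
     (\<forall>p\<in>W. \<forall>u w M. control T \<eta> u \<longrightarrow> control T \<eta> w \<longrightarrow> (\<forall>s\<in>{0..T}. norm (u s - w s) \<le> M) \<longrightarrow>
       (\<forall>t\<in>{0..T}. norm (F (future p u t) - F (future p w t)) \<le> M / 2))"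

text \<open>
  First \<open>\<eta>\<close> is chosen from the \<open>\<delta>\<close>'s of the uniform neighborhood and of the Lipschitz condition, then the
  time is shortened. Shrinking \<open>T\<close> does not affect \<open>\<eta>\<close>, so the contraction factor \<open>L T \<le> 1 / 2\<close> is available
  for the self-map property as well: \<open>F (future p u t)\<close> differs by at most \<open>\<eta> / 2\<close> from its value for
  \<open>u = 0\<close>, and that value differs by at most \<open>\<eta> / 2\<close> from \<open>F p\<close> for short times and data near \<open>p0\<close>.
\<close>

lemma ex_contraction_box:
  assumes p0: "p0 \<in> D"
  shows "\<exists>T \<eta> W. contraction_box T \<eta> W \<and> p0 \<in> W"
proof -
  obtain T1 \<delta>1 W1 V1 where 1: "T1 > 0" "\<delta>1 > 0" "nbhd phase p0 W1" "nbhd euclidean (F p0) V1"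
    "(\<Union>(\<sigma>, \<psi>)\<in>W1. \<Union>v\<in>V1. Lambda1 I \<sigma> \<psi> T1 \<delta>1 v) \<subseteq> D"
    using D_uniform[rule_format, OF p0] unfolding uniform_nbhd_by_C1_prolongations_def by meson
  obtain W2 T2 \<delta>2 L where 2: "nbhd phase p0 W2" "T2 > 0" "\<delta>2 > 0" "L > 0"
    "\<And>\<sigma> \<psi> t \<phi>1 \<phi>2. (\<sigma>, \<psi>) \<in> W2 \<Longrightarrow> (t, \<phi>1) \<in> Lambda1 I \<sigma> \<psi> T2 \<delta>2 (F (\<sigma>, \<psi>)) \<inter> D \<Longrightarrow>
       (t, \<phi>2) \<in> Lambda1 I \<sigma> \<psi> T2 \<delta>2 (F (\<sigma>, \<psi>)) \<inter> D \<Longrightarrow>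
       compact (supp_on I (\<lambda>\<theta>. \<phi>1 \<theta> - \<phi>2 \<theta>)) \<Longrightarrow> Lip_ineq I F L t \<phi>1 \<phi>2"
    using F_Lipschitz[unfolded unif_loc_Lipschitz_about_C1_prolongations_def, rule_format, OF p0] by fast
  obtain r where r: "r > 0" "\<And>t f. t \<in> {0..r} \<Longrightarrow> (\<forall>\<theta>\<in>I. \<theta> < -t \<longrightarrow> (f \<theta> :: 'e) = 0) \<Longrightarrow> compact (supp_on I f)"
    using past_interval_compact_supp[OF past] by metis
  obtain \<eta> where \<eta>: "\<eta> > 0" "ennreal ((T1 + T2 + 1) * \<eta>) \<le> min \<delta>1 \<delta>2"
    using ennreal_scaled_below[of "min \<delta>1 \<delta>2" "T1 + T2 + 1"] 1 2 by auto
  have \<eta>1: "ennreal ((T1 + 1) * \<eta>) \<le> \<delta>1" and \<eta>2: "ennreal ((T2 + 1) * \<eta>) \<le> \<delta>2"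
  proof -
    have "ennreal ((T1 + 1) * \<eta>) \<le> ennreal ((T1 + T2 + 1) * \<eta>)" "ennreal ((T2 + 1) * \<eta>) \<le> ennreal ((T1 + T2 + 1) * \<eta>)"
      using 1 2 \<eta> by (auto intro!: ennreal_leI mult_right_mono)
    then show "ennreal ((T1 + 1) * \<eta>) \<le> \<delta>1" "ennreal ((T2 + 1) * \<eta>) \<le> \<delta>2" using \<eta>(2) by auto
  qed
  define T0 where "T0 = min (min T1 T2) (min r (1 / (2 * L)))"
  have T0: "T0 > 0" "T0 \<le> T1" "T0 \<le> T2" "T0 \<le> r" "T0 \<le> 1 / (2 * L)"
    using 1 2 r by (auto simp: T0_def)
  have LT0: "L * T0 \<le> 1 / 2" using T0(5) 2(4) by (simp add: field_simps)
  define W where "W = phase interior_of W1 \<inter> phase interior_of W2 \<inter> {p \<in> topspace phase. F p \<in> interior V1}"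
  have "openin phase {p \<in> topspace phase. F p \<in> interior V1}"
    using F_continuous by (rule openin_continuous_map_preimage) auto
  then have Wop: "openin phase W" unfolding W_def
    by (intro openin_Int openin_interior_of)
  have p0W: "p0 \<in> W" using 1(3,4) 2(1) p0 topspace_phase by (auto simp: W_def nbhd_def)
  have WD: "W \<subseteq> D" using topspace_phase by (auto simp: W_def)
  have W12: "p \<in> W1 \<and> p \<in> W2 \<and> F p \<in> V1" if "p \<in> W" for p
    using that interior_of_subset[of phase W1] interior_of_subset[of phase W2] interior_subset[of V1]
    unfolding W_def by auto
  have inD: "future p u t \<in> D" if "p \<in> W" "control t \<eta> u" "t \<in> {0..T0}" for p u t
  proof -
    have "future p u t \<in> Lambda1 I (fst p) (snd p) T1 \<delta>1 (F p)"
      using that WD T0 by (intro future_in_Lambda1[OF _ _ _ _ \<eta>1]) auto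
    then show ?thesis using 1(5) W12[OF that(1)] by (cases p) auto
  qed
  have lip: "norm (F (future p u t) - F (future p w t)) \<le> M / 2"
    if p: "p \<in> W" and u: "control t \<eta> u" and w: "control t \<eta> w" and t: "t \<in> {0..T0}"
      and M: "\<forall>s\<in>{0..t}. norm (u s - w s) \<le> M" for p u w t M
  proof -
    have M0: "M \<ge> 0" using M t norm_ge_zero order_trans by (metis atLeastAtMost_iff order_refl)
    have supp: "compact (supp_on I (\<lambda>\<theta>. snd (future p u t) \<theta> - snd (future p w t) \<theta>))"
      using t T0 by (intro r(2)[of t]) (auto simp: future_def seg_def prolong_by_def primitive_nonpos)
    have "future p u t \<in> Lambda1 I (fst p) (snd p) T2 \<delta>2 (F p)" "future p w t \<in> Lambda1 I (fst p) (snd p) T2 \<delta>2 (F p)"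
      using that WD T0 by (auto intro!: future_in_Lambda1[OF _ _ _ _ \<eta>2])
    moreover have "future p u t = (fst p + t, snd (future p u t))" for u by (simp add: future_def)
    ultimately have "Lip_ineq I F L (fst p + t) (snd (future p u t)) (snd (future p w t))"
      using W12[OF p] inD[OF p u t] inD[OF p w t] supp by (intro 2(5)[of "fst p" "snd p"]) auto
    then have "norm (F (future p u t) - F (future p w t)) \<le> L * (M * t)"
      using u w t M 2 p WD by (intro future_Lip) (auto simp: control_def)
    also have "\<dots> \<le> L * (M * T0)" using 2(4) M0 t by (intro mult_left_mono) auto
    also have "\<dots> = M * (L * T0)" by simp
    also have "\<dots> \<le> M * (1 / 2)" using LT0 M0 by (rule mult_left_mono)
    finally show ?thesis by simp
  qed
  have zero: "control t \<eta> (\<lambda>_. 0)" for t using \<eta> by (auto simp: control_def)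
  let ?Z = "prod_topology (top_of_set {0..T0}) (subtopology RH W)"
  have topZ: "topspace ?Z = {0..T0} \<times> W" using WD D_subset by auto
  have "continuous_map ?Z euclidean (\<lambda>z. F (future (snd z) (\<lambda>_. 0) (fst z)) - F (snd z))"
  proof (intro continuous_map_diff)
    show "continuous_map ?Z euclidean (\<lambda>z. F (future (snd z) (\<lambda>_. 0) (fst z)))"
      by (rule continuous_map_compose[OF continuous_map_future F_continuous, unfolded o_def])
         (use WD inD zero in auto)
    show "continuous_map ?Z euclidean (\<lambda>z. F (snd z))"
      by (rule continuous_map_compose[OF _ F_continuous, unfolded o_def])
         (use WD topZ continuous_map_snd[of "top_of_set {0..T0}" "subtopology RH W"] in
           \<open>auto simp: continuous_map_in_subtopology Pi_iff\<close>)
  qed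
  then have "openin ?Z {z \<in> topspace ?Z. F (future (snd z) (\<lambda>_. 0) (fst z)) - F (snd z) \<in> ball 0 (\<eta> / 2)}"
    by (rule openin_continuous_map_preimage) auto
  moreover have "(0, p0) \<in> {z \<in> topspace ?Z. F (future (snd z) (\<lambda>_. 0) (fst z)) - F (snd z) \<in> ball 0 (\<eta> / 2)}"
    unfolding topZ using T0 p0W \<eta> future_0[OF p0] by auto
  ultimately obtain A B where AB: "openin (top_of_set {0..T0}) A" "openin (subtopology RH W) B" "0 \<in> A" "p0 \<in> B"
    "A \<times> B \<subseteq> {z \<in> topspace ?Z. F (future (snd z) (\<lambda>_. 0) (fst z)) - F (snd z) \<in> ball 0 (\<eta> / 2)}"
    unfolding openin_prod_topology_alt by meson
  obtain e where e: "e > 0" "\<And>t. t \<in> {0..T0} \<Longrightarrow> dist t 0 < e \<Longrightarrow> t \<in> A"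
    using AB(1,3) unfolding openin_euclidean_subtopology_iff by blast
  define T where "T = min T0 (e / 2)"
  have T: "0 < T" "T \<le> T0" "{0..T} \<subseteq> A" using T0 e by (auto simp: T_def)
  have BW: "B \<subseteq> W" using openin_subset[OF AB(2)] by auto
  have "subtopology phase W = subtopology RH W" using WD by (simp add: subtopology_subtopology Int_absorb1)
  then have Bop: "openin phase B" using openin_trans_full[OF _ Wop] AB(2) by simp
  have "norm (F (future p u t) - F p) \<le> \<eta>" if p: "p \<in> B" and u: "control T \<eta> u" and t: "t \<in> {0..T}" for p u t
  proof -
    have "norm (F (future p u t) - F (future p (\<lambda>_. 0) t)) \<le> \<eta> / 2"
      using control_mono[OF u] zero p BW t T u by (intro lip) (auto simp: control_def)
    moreover have "norm (F (future p (\<lambda>_. 0) t) - F p) \<le> \<eta> / 2"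
    proof -
      have "(t, p) \<in> A \<times> B" using p t T by auto
      with AB(5) have "F (future p (\<lambda>_. 0) t) - F p \<in> ball 0 (\<eta> / 2)" by auto
      then show ?thesis by simp
    qed
    ultimately show ?thesis
      using norm_triangle_ineq[of "F (future p u t) - F (future p (\<lambda>_. 0) t)" "F (future p (\<lambda>_. 0) t) - F p"]
      by simp
  qed
  moreover have "future p u t \<in> D" if p: "p \<in> B" and u: "control T \<eta> u" and t: "t \<in> {0..T}" for p u t
    using that control_mono[OF u, of t] BW T by (intro inD) auto
  moreover have "norm (F (future p u t) - F (future p w t)) \<le> M / 2"
    if "p \<in> B" "control T \<eta> u" "control T \<eta> w" "\<forall>s\<in>{0..T}. norm (u s - w s) \<le> M" "t \<in> {0..T}" for p u w M t
    using that control_mono[OF that(2), of t] control_mono[OF that(3), of t] BW T by (intro lip) auto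
  ultimately have "contraction_box T \<eta> B" unfolding contraction_box_def using T \<eta>(1) Bop by blast
  then show ?thesis using AB(4) by blast
qed

end

section \<open>The fixed point and its dependence on the datum\<close>

text \<open>
  Functions on \<open>[0, T]\<close> are represented by functions on the whole line that are constant outside
  \<open>[0, T]\<close>, so that the complete space of bounded continuous functions on \<open>\<real>\<close> can be used.
\<close>

definition hold :: "real \<Rightarrow> real \<Rightarrow> real" where
  "hold T s = max 0 (min T s)"

lemma hold_in: "0 \<le> T \<Longrightarrow> hold T s \<in> {0..T}"
  by (auto simp: hold_def)

lemma hold_id: "s \<in> {0..T} \<Longrightarrow> hold T s = s"
  by (auto simp: hold_def)

lemma continuous_on_hold: "continuous_on S (hold T)"
  unfolding hold_def[abs_def] by (intro continuous_intros)

lemma continuous_on_hold_compose: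
  assumes "continuous_on {0..T} g" "0 \<le> T"
  shows "continuous_on UNIV (\<lambda>s. g (hold T s))"
  by (rule continuous_on_compose2[OF assms(1) continuous_on_hold]) (use hold_in[OF assms(2)] in blast)

lemma continuous_on_eval_bcontfun: "continuous_on S (\<lambda>u. apply_bcontfun u s)"
  unfolding continuous_on_iff using dist_fun_lt_imp_dist_val_lt by blast

context history_ivp
begin

lemma contraction_boxD:
  assumes "contraction_box T \<eta> W"
  shows "T > 0" "\<eta> > 0" "openin phase W" "W \<subseteq> D"
    and "\<And>p u t. p \<in> W \<Longrightarrow> control T \<eta> u \<Longrightarrow> t \<in> {0..T} \<Longrightarrow> future p u t \<in> D"
    and "\<And>p u t. p \<in> W \<Longrightarrow> control T \<eta> u \<Longrightarrow> t \<in> {0..T} \<Longrightarrow> norm (F (future p u t) - F p) \<le> \<eta>"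
    and "\<And>p u w M t. p \<in> W \<Longrightarrow> control T \<eta> u \<Longrightarrow> control T \<eta> w \<Longrightarrow> (\<And>s. s \<in> {0..T} \<Longrightarrow> norm (u s - w s) \<le> M) \<Longrightarrow>
       t \<in> {0..T} \<Longrightarrow> norm (F (future p u t) - F (future p w t)) \<le> M / 2"
  using assms openin_subset[of phase W] topspace_phase unfolding contraction_box_def by blast+

definition controls :: "real \<Rightarrow> real \<Rightarrow> (real \<Rightarrow>\<^sub>C 'e) set" where
  "controls T \<eta> = {u. control T \<eta> (apply_bcontfun u)}"

lemma complete_controls: "complete (controls T \<eta>)"
proof -
  have "controls T \<eta> = {u. apply_bcontfun u 0 = 0} \<inter> (\<Inter>s\<in>{0..T}. {u. norm (apply_bcontfun u s) \<le> \<eta>})"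
    by (auto simp: controls_def control_def)
  also have "closed \<dots>"
    by (intro closed_Int closed_INT ballI closed_Collect_eq closed_Collect_le continuous_on_norm
        continuous_on_const continuous_on_eval_bcontfun)
  finally show ?thesis by (simp add: complete_eq_closed)
qed

lemma continuous_on_F_future:
  assumes p: "p \<in> D" and u: "continuous_on UNIV u" and D: "\<And>t. t \<in> {0..T} \<Longrightarrow> future p u t \<in> D"
  shows "continuous_on {0..T} (\<lambda>t. F (future p u t))"
proof -
  have "continuous_map (top_of_set {0..T}) (prod_topology (top_of_set {0..T}) (subtopology RH {p})) (\<lambda>t. (t, p))"
    using p D_subset by (auto intro!: continuous_map_pairedI continuous_map_id[unfolded id_def])
  moreover have "continuous_map (prod_topology (top_of_set {0..T}) (subtopology RH {p})) euclidean
      (\<lambda>z. F (future (snd z) u (fst z)))"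
    by (rule continuous_map_compose[OF continuous_map_future F_continuous, unfolded o_def]) (use p u D in auto)
  ultimately have "continuous_map (top_of_set {0..T}) euclidean (\<lambda>t. F (future p u t))"
    by (auto dest: continuous_map_compose simp: o_def)
  then show ?thesis by simp
qed

definition picard :: "real \<Rightarrow> real \<times> (real \<Rightarrow> 'e) \<Rightarrow> (real \<Rightarrow>\<^sub>C 'e) \<Rightarrow> (real \<Rightarrow>\<^sub>C 'e)" where
  "picard T p u = Bcontfun (\<lambda>s. F (future p (apply_bcontfun u) (hold T s)) - F p)"

lemma apply_picard:
  assumes box: "contraction_box T \<eta> W" and p: "p \<in> W" and u: "u \<in> controls T \<eta>"
  shows "apply_bcontfun (picard T p u) = (\<lambda>s. F (future p (apply_bcontfun u) (hold T s)) - F p)"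
proof -
  note b = contraction_boxD[OF box]
  have u': "control T \<eta> (apply_bcontfun u)" using u by (simp add: controls_def)
  have T: "0 \<le> T" using b(1) by simp
  have "continuous_on {0..T} (\<lambda>t. F (future p (apply_bcontfun u) t))"
    using b p u' by (intro continuous_on_F_future) (auto simp: control_def)
  from continuous_on_hold_compose[OF this T]
  have "continuous_on UNIV (\<lambda>s. F (future p (apply_bcontfun u) (hold T s)) - F p)"
    by (intro continuous_intros)
  moreover have "bounded (range (\<lambda>s. F (future p (apply_bcontfun u) (hold T s)) - F p))"
    using b(6)[OF p u' hold_in[OF T]] by (auto simp: bounded_iff)
  ultimately show ?thesis unfolding picard_def by (subst Bcontfun_inverse) (auto simp: bcontfun_def)
qed

lemma picard_in_controls:
  assumes box: "contraction_box T \<eta> W" and p: "p \<in> W" and u: "u \<in> controls T \<eta>"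
  shows "picard T p u \<in> controls T \<eta>"
proof -
  note b = contraction_boxD[OF box]
  have u': "control T \<eta> (apply_bcontfun u)" using u by (simp add: controls_def)
  have "hold T 0 = 0" using b(1) by (simp add: hold_def)
  then have "apply_bcontfun (picard T p u) 0 = 0"
    using future_0[of p] p b(4) by (auto simp: apply_picard[OF assms])
  moreover have "norm (apply_bcontfun (picard T p u) s) \<le> \<eta>" if "s \<in> {0..T}" for s
    using b(6)[OF p u' that] that by (simp add: apply_picard[OF assms] hold_id)
  ultimately show ?thesis by (simp add: controls_def control_def)
qed

lemma picard_contraction:
  assumes box: "contraction_box T \<eta> W" and p: "p \<in> W" and u: "u \<in> controls T \<eta>" and w: "w \<in> controls T \<eta>"
  shows "dist (picard T p u) (picard T p w) \<le> 1 / 2 * dist u w"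
proof (rule dist_bound)
  fix s
  note b = contraction_boxD[OF box]
  have "norm (F (future p (apply_bcontfun u) (hold T s)) - F (future p (apply_bcontfun w) (hold T s))) \<le> dist u w / 2"
    using u w b(1) dist_bounded[of u _ w]
    by (intro b(7)[OF p] hold_in) (auto simp: controls_def dist_norm)
  then show "dist (apply_bcontfun (picard T p u) s) (apply_bcontfun (picard T p w) s) \<le> 1 / 2 * dist u w"
    by (simp add: apply_picard[OF box p u] apply_picard[OF box p w] dist_norm)
qed

definition solution_excess :: "real \<Rightarrow> real \<Rightarrow> real \<times> (real \<Rightarrow> 'e) \<Rightarrow> (real \<Rightarrow>\<^sub>C 'e)" where
  "solution_excess T \<eta> p = (SOME u. u \<in> controls T \<eta> \<and> picard T p u = u)"

lemma solution_excess:
  assumes box: "contraction_box T \<eta> W" and p: "p \<in> W"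
  shows "solution_excess T \<eta> p \<in> controls T \<eta>" "picard T p (solution_excess T \<eta> p) = solution_excess T \<eta> p"
proof -
  have "const_bcontfun 0 \<in> controls T \<eta>"
    using contraction_boxD(2)[OF box] by (simp add: controls_def control_def const_bcontfun.rep_eq)
  then have "\<exists>!u\<in>controls T \<eta>. picard T p u = u"
    using picard_in_controls[OF box p] picard_contraction[OF box p]
    by (intro Banach_fix[of _ "1/2"] complete_controls) auto
  then have "\<exists>u. u \<in> controls T \<eta> \<and> picard T p u = u" by blast
  from someI_ex[OF this] show "solution_excess T \<eta> p \<in> controls T \<eta>" "picard T p (solution_excess T \<eta> p) = solution_excess T \<eta> p"
    unfolding solution_excess_def by blast+
qed

text \<open>
  Fixed points of uniform contractions depend continuously on the parameter as soon as the image of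
  one fixed \<open>w\<close> does, in the supremum norm over \<open>[0, T]\<close>. Pointwise in time this is joint continuity of
  \<open>F (future p w t)\<close>; the tube lemma makes it uniform in \<open>t\<close>.
\<close>

lemma solution_excess_continuous:
  assumes box: "contraction_box T \<eta> W" and p1: "p1 \<in> W" and e: "e > 0"
  shows "\<exists>V. openin (subtopology RH W) V \<and> p1 \<in> V \<and> (\<forall>p\<in>V. dist (solution_excess T \<eta> p) (solution_excess T \<eta> p1) \<le> e)"
proof -
  note b = contraction_boxD[OF box]
  define w where "w = solution_excess T \<eta> p1"
  have w: "w \<in> controls T \<eta>" "picard T p1 w = w" using solution_excess[OF box p1] by (simp_all add: w_def)
  then have w': "control T \<eta> (apply_bcontfun w)" by (simp add: controls_def)
  let ?Z = "prod_topology (top_of_set {0..T}) (subtopology RH W)"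
  let ?g = "\<lambda>z. F (future (snd z) (apply_bcontfun w) (fst z)) - F (snd z)"
  have topZ: "topspace ?Z = {0..T} \<times> W" using b(4) D_subset by auto
  have snd: "continuous_map ?Z phase snd"
    using b(4) topZ continuous_map_snd[of "top_of_set {0..T}" "subtopology RH W"]
    by (auto simp: continuous_map_in_subtopology Pi_iff)
  have fut: "continuous_map ?Z phase (\<lambda>z. future (snd z) (apply_bcontfun w) (fst z))"
    using b w' by (intro continuous_map_future) (auto simp: control_def)
  have g: "continuous_map ?Z euclidean ?g"
    by (intro continuous_map_diff continuous_map_compose[OF _ F_continuous, unfolded o_def] snd fut)
  have fstp: "continuous_map ?Z ?Z (\<lambda>z. (fst z, p1))"
    using p1 b(4) D_subset by (auto intro!: continuous_map_pairedI continuous_map_fst)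
  have "continuous_map ?Z euclidean (\<lambda>z. ?g z - ?g (fst z, p1))"
    by (rule continuous_map_diff[OF g continuous_map_compose[OF fstp g, unfolded o_def]])
  then have op: "openin ?Z {z \<in> topspace ?Z. ?g z - ?g (fst z, p1) \<in> ball 0 (e / 2)}"
    by (rule openin_continuous_map_preimage) auto
  have comp: "compactin (top_of_set {0..T}) {0..T}"
    by (simp add: compactin_subtopology)
  have p1W: "p1 \<in> topspace (subtopology RH W)" using p1 b(4) D_subset by auto
  have slice: "{0..T} \<times> {p1} \<subseteq> {z \<in> topspace ?Z. ?g z - ?g (fst z, p1) \<in> ball 0 (e / 2)}"
    unfolding topZ using p1 e by auto
  obtain A V where AV: "openin (subtopology RH W) V" "{0..T} \<subseteq> A" "p1 \<in> V"
      "A \<times> V \<subseteq> {z \<in> topspace ?Z. ?g z - ?g (fst z, p1) \<in> ball 0 (e / 2)}"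
    using tube_lemma_left[OF op comp p1W slice] by blast
  have "dist (solution_excess T \<eta> p) w \<le> e" if p: "p \<in> V" for p
  proof -
    have pW: "p \<in> W" using openin_subset[OF AV(1)] p by auto
    define u where "u = solution_excess T \<eta> p"
    have u: "u \<in> controls T \<eta>" "picard T p u = u" using solution_excess[OF box pW] by (simp_all add: u_def)
    \<comment> \<open>With contraction factor \<open>1 / 2\<close>, an error of \<open>e / 2\<close> in one step moves the fixed point by at most \<open>e\<close>.\<close>
    have "dist (picard T p w) (picard T p1 w) \<le> e / 2"
    proof (rule dist_bound)
      fix s
      have "(hold T s, p) \<in> A \<times> V" using p AV(2) hold_in[of T s] b(1) by auto
      with AV(4) have "?g (hold T s, p) - ?g (hold T s, p1) \<in> ball 0 (e / 2)" by auto
      then have "norm (?g (hold T s, p) - ?g (hold T s, p1)) < e / 2" by (simp only: mem_ball_0)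
      then show "dist (apply_bcontfun (picard T p w) s) (apply_bcontfun (picard T p1 w) s) \<le> e / 2"
        by (simp add: apply_picard[OF box pW w(1)] apply_picard[OF box p1 w(1)] dist_norm)
    qed
    moreover have "dist (picard T p u) (picard T p w) \<le> 1 / 2 * dist u w"
      by (rule picard_contraction[OF box pW u(1) w(1)])
    ultimately show ?thesis
      using dist_triangle[of "picard T p u" "picard T p1 w" "picard T p w"] u(2) w(2)
      by (simp add: u_def[symmetric])
  qed
  then show ?thesis using AV(1,3) by (auto simp: w_def)
qed

text \<open>
  Near \<open>(t1, p1)\<close> the segment is the one for the fixed control \<open>w\<close> at \<open>p1\<close>, which is continuous in time,
  plus the segment of the primitive of a uniformly small control, which is small in \<open>H\<close> by regulation.
\<close>

lemma continuous_map_seg_primitive_solution_excess: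
  assumes box: "contraction_box T \<eta> W"
  shows "continuous_map (prod_topology (top_of_set {0..T}) (subtopology RH W)) H
     (\<lambda>z. seg I (fst z) (primitive (apply_bcontfun (solution_excess T \<eta> (snd z)))))"
    (is "continuous_map ?Z H ?R")
proof -
  note b = contraction_boxD[OF box]
  have topZ: "topspace ?Z = {0..T} \<times> W" using b(4) D_subset by auto
  have pr: "continuous_map (top_of_set {0..T}) H (\<lambda>t. seg I t (primitive (apply_bcontfun w)))" for w
    by (rule continuous_map_from_subtopology_mono[OF continuous_map_seg_primitive]) auto
  have RH': "seg I t (primitive (apply_bcontfun w)) \<in> topspace H" if "t \<in> {0..T}" for t w
    using pr[of w] that by (auto simp: continuous_map_def Pi_iff)
  have "topcontinuous_at ?Z H ?R z" if z: "z \<in> topspace ?Z" for z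
    unfolding topcontinuous_at_def
  proof (intro conjI allI impI)
    obtain t1 p1 where z1: "z = (t1, p1)" and t1: "t1 \<in> {0..T}" and p1: "p1 \<in> W" using z topZ by auto
    show "z \<in> topspace ?Z" by fact
    show "?R \<in> topspace ?Z \<rightarrow> topspace H" using RH' topZ by auto
    fix B assume B: "openin H B \<and> ?R z \<in> B"
    define w where "w = apply_bcontfun (solution_excess T \<eta> p1)"
    have wc: "continuous_on UNIV w" "w 0 = 0"
      using solution_excess(1)[OF box p1] by (auto simp: w_def controls_def control_def)
    have "continuous_map (prod_topology H H) H (\<lambda>(\<phi>, \<psi>). (\<lambda>\<theta>. \<phi> \<theta> + \<psi> \<theta>))"
      using history by (simp add: history_space_def)
    from openin_continuous_map_preimage[OF this conjunct1[OF B]]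
    have op: "openin (prod_topology H H) {z \<in> topspace (prod_topology H H). (\<lambda>(\<phi>, \<psi>). (\<lambda>\<theta>. \<phi> \<theta> + \<psi> \<theta>)) z \<in> B}" .
    have "(?R z, \<lambda>_. 0) \<in> {z \<in> topspace (prod_topology H H). (\<lambda>(\<phi>, \<psi>). (\<lambda>\<theta>. \<phi> \<theta> + \<psi> \<theta>)) z \<in> B}"
      using B RH'[OF t1] zero_in_H by (simp add: z1)
    with op obtain A N where AN: "openin H A" "openin H N" "?R z \<in> A" "(\<lambda>_. 0) \<in> N"
        "A \<times> N \<subseteq> {z \<in> topspace (prod_topology H H). (\<lambda>(\<phi>, \<psi>). (\<lambda>\<theta>. \<phi> \<theta> + \<psi> \<theta>)) z \<in> B}"
      unfolding openin_prod_topology_alt by meson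
    obtain e where e: "e > 0" "\<And>u t. continuous_on UNIV u \<Longrightarrow> u 0 = 0 \<Longrightarrow> \<forall>s\<in>{0..t}. norm (u s) \<le> e \<Longrightarrow>
        t \<in> {0..T} \<Longrightarrow> seg I t (primitive u) \<in> N"
      using seg_primitive_small[OF AN(2,4) b(1)] by meson
    obtain V where V: "openin (subtopology RH W) V" "p1 \<in> V"
        "\<And>p. p \<in> V \<Longrightarrow> dist (solution_excess T \<eta> p) (solution_excess T \<eta> p1) \<le> e"
      using solution_excess_continuous[OF box p1 e(1)] by meson
    define J where "J = {t \<in> topspace (top_of_set {0..T}). seg I t (primitive w) \<in> A}"
    have J: "openin (top_of_set {0..T}) J"
      unfolding J_def w_def using pr AN(1) by (rule openin_continuous_map_preimage)
    have "?R y \<in> B" if y: "y \<in> J \<times> V" for y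
    proof -
      obtain t p where tp: "y = (t, p)" and t: "t \<in> J" and p: "p \<in> V" using y by auto
      have pW: "p \<in> W" using openin_subset[OF V(1)] p by auto
      have tT: "t \<in> {0..T}" using t by (simp add: J_def)
      define u where "u = apply_bcontfun (solution_excess T \<eta> p)"
      have uc: "continuous_on UNIV u" "u 0 = 0"
        using solution_excess(1)[OF box pW] by (auto simp: u_def controls_def control_def)
      have "norm (u s - w s) \<le> e" for s
        using dist_bounded[of "solution_excess T \<eta> p" s "solution_excess T \<eta> p1"] V(3)[OF p]
        by (simp add: u_def w_def dist_norm)
      then have "seg I t (primitive (\<lambda>s. u s - w s)) \<in> N"
        using uc wc tT by (intro e(2)) (auto intro!: continuous_on_diff)
      moreover have "seg I t (primitive w) \<in> A" using t by (simp add: J_def)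
      ultimately have "(\<lambda>\<theta>. seg I t (primitive w) \<theta> + seg I t (primitive (\<lambda>s. u s - w s)) \<theta>) \<in> B"
        using subsetD[OF AN(5), of "(seg I t (primitive w), seg I t (primitive (\<lambda>s. u s - w s)))"] by simp
      moreover have "(\<lambda>\<theta>. seg I t (primitive w) \<theta> + seg I t (primitive (\<lambda>s. u s - w s)) \<theta>) = seg I t (primitive u)"
        by (auto simp: seg_def primitive_diff[OF uc(1) wc(1)])
      ultimately show ?thesis by (simp add: tp u_def)
    qed
    moreover have "openin ?Z (J \<times> V)" using J V(1) by (simp add: openin_prod_Times_iff)
    moreover have "z \<in> J \<times> V" using z1 t1 V(2) AN(3) by (simp add: J_def w_def)
    ultimately show "\<exists>U. openin ?Z U \<and> z \<in> U \<and> (\<forall>y\<in>U. ?R y \<in> B)" by blast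
  qed
  then show ?thesis unfolding continuous_map_eq_topcontinuous_at by blast
qed

lemma continuous_map_seg_prolong_by_solution_excess:
  assumes box: "contraction_box T \<eta> W"
  shows "continuous_map (prod_topology (top_of_set {0..T}) (subtopology RH W)) H
     (\<lambda>z. seg I (fst z) (prolong_by (snd (snd z)) (F (snd z)) (apply_bcontfun (solution_excess T \<eta> (snd z)))))"
    (is "continuous_map ?Z H _")
proof -
  note b = contraction_boxD[OF box]
  have topZ: "topspace ?Z = {0..T} \<times> W" using b(4) D_subset by auto
  have p: "continuous_map ?Z phase snd"
    using b(4) topZ continuous_map_snd[of "top_of_set {0..T}" "subtopology RH W"]
    by (auto simp: continuous_map_in_subtopology Pi_iff)
  have t: "continuous_map ?Z (top_of_set {0..}) fst"
    using continuous_map_fst[of "top_of_set {0..T}" "subtopology RH W"]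
    by (auto simp: continuous_map_in_subtopology Pi_iff)
  have "continuous_map ?Z H (\<lambda>z. snd (snd z))"
    using p by (auto simp: continuous_map_in_subtopology continuous_map_pairwise o_def)
  then show ?thesis
    unfolding seg_prolong_by
    by (intro continuous_map_H_add continuous_map_S_shift t continuous_map_seg_primitive_solution_excess[OF box]
        continuous_map_compose[OF p F_continuous, unfolded o_def])
qed

end

section \<open>Solutions on compact intervals\<close>

lemma has_vector_derivative_within_Un:
  "(f has_vector_derivative f') (at x within S) \<Longrightarrow> (f has_vector_derivative f') (at x within T) \<Longrightarrow>
   (f has_vector_derivative f') (at x within S \<union> T)"
  unfolding has_vector_derivative_def has_derivative_within Lim_within_Un by blast

lemma has_vector_derivative_concat:
  fixes f :: "real \<Rightarrow> 'e::real_normed_vector"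
  assumes l: "\<And>t. t \<in> {a..b} \<Longrightarrow> (f has_vector_derivative f' t) (at t within {a..b})"
    and r: "\<And>t. t \<in> {b..c} \<Longrightarrow> (f has_vector_derivative f' t) (at t within {b..c})"
    and ab: "a \<le> b" "b \<le> c" and t: "t \<in> {a..c}"
  shows "(f has_vector_derivative f' t) (at t within {a..c})"
proof -
  consider "t < b" | "t = b" | "t > b" by linarith
  then show ?thesis
  proof cases
    case 1
    then have "at t within {a..c} = at t within {a..b}"
      using ab by (intro at_within_nhd[of t "{..<b}"]) auto
    then show ?thesis using l[of t] 1 t by simp
  next
    case 2
    have "{a..c} = {a..b} \<union> {b..c}" using ab by auto
    then show ?thesis using has_vector_derivative_within_Un[OF l[of b] r[of b]] 2 ab by simp
  next
    case 3
    then have "at t within {a..c} = at t within {b..c}"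
      using ab by (intro at_within_nhd[of t "{b<..}"]) auto
    then show ?thesis using r[of t] 3 t by simp
  qed
qed

lemma seg_eq_if_agree:
  assumes I: "past_interval I" and seg: "seg I a x = seg I a y" and agree: "\<And>s. s \<in> {a..t} \<Longrightarrow> x s = y s"
    and t: "a \<le> t"
  shows "seg I t x = seg I t y"
proof (rule seg_cong)
  fix \<theta> assume \<theta>: "\<theta> \<in> I"
  show "x (t + \<theta>) = y (t + \<theta>)"
  proof (cases "t + \<theta> \<ge> a")
    case True
    then show ?thesis using past_interval_nonpos[OF I \<theta>] by (intro agree) auto
  next
    case False
    then have "t + \<theta> - a \<in> I" using t by (intro past_interval_between[OF I \<theta>]) auto
    from segD[OF seg this] show ?thesis by simp
  qed
qed

context history_ivp
begin

text \<open>
  Solutions on compact intervals, without any convention on the values outside \<open>[a, b] + I\<close>. This makes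
  restriction trivial, since one and the same \<open>x\<close> can be restarted at every intermediate time. The interval
  may be degenerate; then only membership in the domain remains. Continuity of the right-hand side
  expresses that \<open>x\<close> is of class \<open>C\<^sup>1\<close>.
\<close>

definition solves :: "real \<Rightarrow> real \<Rightarrow> (real \<Rightarrow> 'e) \<Rightarrow> bool" where
  "solves a b x \<longleftrightarrow>
     (\<forall>t\<in>{a..b}. (t, seg I t x) \<in> D \<and> (x has_vector_derivative F (t, seg I t x)) (at t within {a..b})) \<and>
     continuous_on {a..b} (\<lambda>t. F (t, seg I t x))"

lemma solvesD:
  assumes "solves a b x"
  shows "t \<in> {a..b} \<Longrightarrow> (t, seg I t x) \<in> D"
    and "t \<in> {a..b} \<Longrightarrow> (x has_vector_derivative F (t, seg I t x)) (at t within {a..b})"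
    and "continuous_on {a..b} (\<lambda>t. F (t, seg I t x))"
  using assms by (auto simp: solves_def)

lemma solves_subinterval:
  assumes "solves a b x" "a \<le> c" "d \<le> b"
  shows "solves c d x"
proof -
  have sub: "{c..d} \<subseteq> {a..b}" using assms by auto
  then show ?thesis
    using solvesD[OF assms(1)] unfolding solves_def
    by (meson continuous_on_subset has_vector_derivative_within_subset subsetD)
qed

lemma solves_cong:
  assumes x: "solves a b x" and eq: "\<And>t \<theta>. t \<in> {a..b} \<Longrightarrow> \<theta> \<in> I \<Longrightarrow> y (t + \<theta>) = x (t + \<theta>)"
  shows "solves a b y"
proof -
  have seg: "seg I t y = seg I t x" if "t \<in> {a..b}" for t using eq[OF that] by (rule seg_cong)
  have val: "y t = x t" if "t \<in> {a..b}" for t using eq[OF that past_interval_0[OF past]] by simp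
  have "continuous_on {a..b} (\<lambda>t. F (t, seg I t y))"
    using solvesD(3)[OF x] by (rule continuous_on_eq) (simp add: seg)
  moreover have "(y has_vector_derivative F (t, seg I t y)) (at t within {a..b})" if t: "t \<in> {a..b}" for t
    unfolding seg[OF t] using t val solvesD(2)[OF x t] by (rule has_vector_derivative_transform)
  ultimately show ?thesis using solvesD(1)[OF x] seg by (simp add: solves_def)
qed

lemma solves_concat:
  assumes l: "solves a b x" and r: "solves b c x" and ab: "a \<le> b" "b \<le> c"
  shows "solves a c x"
proof -
  have "(x has_vector_derivative F (t, seg I t x)) (at t within {a..c})" if "t \<in> {a..c}" for t
    using solvesD(2)[OF l] solvesD(2)[OF r] ab that by (rule has_vector_derivative_concat)
  moreover have "(t, seg I t x) \<in> D" if "t \<in> {a..c}" for t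
    using solvesD(1)[OF l, of t] solvesD(1)[OF r, of t] that by fastforce
  moreover have "continuous_on ({a..b} \<union> {b..c}) (\<lambda>t. F (t, seg I t x))"
    by (intro continuous_on_closed_Un solvesD[OF l] solvesD[OF r]) auto
  moreover have "{a..b} \<union> {b..c} = {a..c}" using ab by auto
  ultimately show ?thesis by (simp add: solves_def)
qed

definition glue :: "real \<Rightarrow> (real \<Rightarrow> 'e) \<Rightarrow> (real \<Rightarrow> 'e) \<Rightarrow> real \<Rightarrow> 'e" where
  "glue b x z t = (if t \<le> b then x t else z t)"

lemma glue_left: "t \<le> b \<Longrightarrow> \<theta> \<in> I \<Longrightarrow> glue b x z (t + \<theta>) = x (t + \<theta>)"
  using past_interval_nonpos[OF past, of \<theta>] by (simp add: glue_def)

lemma glue_right: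
  assumes "seg I b z = seg I b x" "b \<le> t" "\<theta> \<in> I"
  shows "glue b x z (t + \<theta>) = z (t + \<theta>)"
proof (cases "t + \<theta> \<le> b")
  case True
  then have "t + \<theta> - b \<in> I" using assms by (intro past_interval_between[OF past assms(3)]) auto
  from segD[OF assms(1) this] show ?thesis using True by (simp add: glue_def)
qed (simp add: glue_def)

lemma solves_glue:
  assumes x: "solves a b x" and z: "solves b c z" and seg: "seg I b z = seg I b x" and ab: "a \<le> b" "b \<le> c"
  shows "solves a c (glue b x z)"
proof (rule solves_concat[OF _ _ ab])
  show "solves a b (glue b x z)" by (rule solves_cong[OF x]) (simp add: glue_left)
  show "solves b c (glue b x z)" by (rule solves_cong[OF z]) (simp add: glue_right[OF seg])
qed

lemma seg_glue_left: "t \<le> b \<Longrightarrow> seg I t (glue b x z) = seg I t x"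
  by (rule seg_cong) (simp add: glue_left)

lemma seg_glue_right: "seg I b z = seg I b x \<Longrightarrow> b \<le> t \<Longrightarrow> seg I t (glue b x z) = seg I t z"
  by (rule seg_cong) (simp add: glue_right)

text \<open>
  The control that corresponds to a given solution \<open>x\<close>.
\<close>

definition excess :: "real \<times> (real \<Rightarrow> 'e) \<Rightarrow> real \<Rightarrow> (real \<Rightarrow> 'e) \<Rightarrow> real \<Rightarrow> 'e" where
  "excess p T x s = F (fst p + hold T s, seg I (fst p + hold T s) x) - F p"

lemma solution_as_prolongation:
  assumes T: "0 \<le> T" and x: "solves (fst p) (fst p + T) x" and ini: "seg I (fst p) x = snd p"
  shows "continuous_on UNIV (excess p T x)" "excess p T x 0 = 0"
    and "s \<in> {0..T} \<Longrightarrow> x (fst p + s) = prolong_by (snd p) (F p) (excess p T x) s"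
    and "s \<in> {0..T} \<Longrightarrow> future p (excess p T x) s = (fst p + s, seg I (fst p + s) x)"
    and "s \<in> {0..T} \<Longrightarrow> excess p T x s = F (future p (excess p T x) s) - F p"
proof -
  let ?u = "excess p T x"
  let ?y = "prolong_by (snd p) (F p) ?u"
  have "continuous_on {0..T} (\<lambda>s. F (fst p + s, seg I (fst p + s) x))"
    by (rule continuous_on_compose2[OF solvesD(3)[OF x]]) (auto intro!: continuous_intros)
  from continuous_on_hold_compose[OF this T]
  show uc: "continuous_on UNIV ?u" unfolding excess_def[abs_def] by (intro continuous_intros)
  have "hold T 0 = 0" using T by (simp add: hold_def)
  then show "?u 0 = 0" using ini by (simp add: excess_def)
  have ini_Maps: "snd p \<in> Maps I" using ini seg_in_Maps by metis
  have x0: "x (fst p) = snd p 0" using seg_at_0[OF past_interval_0[OF past], of "fst p" x] ini by simp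
  have "((\<lambda>s. x (fst p + s) - ?y s) has_vector_derivative 0) (at s within {0..T})" if s: "s \<in> {0..T}" for s
  proof -
    have "((\<lambda>s. x (fst p + s)) has_vector_derivative 1 *\<^sub>R F (fst p + s, seg I (fst p + s) x)) (at s within {0..T})"
      using s by (intro vector_diff_chain_within[of "\<lambda>s. fst p + s" 1 s _ x, unfolded o_def]
          has_vector_derivative_within_subset[OF solvesD(2)[OF x]]) (auto intro!: derivative_eq_intros)
    moreover have "(?y has_vector_derivative F p + ?u s) (at s within {0..T})"
      using s by (intro has_vector_derivative_within_subset[OF has_vector_derivative_prolong_by[OF uc]]) auto
    ultimately have "((\<lambda>s. x (fst p + s) - ?y s) has_vector_derivative
        1 *\<^sub>R F (fst p + s, seg I (fst p + s) x) - (F p + ?u s)) (at s within {0..T})"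
      by (rule has_vector_derivative_diff)
    then show ?thesis using s by (simp add: excess_def hold_id)
  qed
  then obtain c where "\<And>s. s \<in> {0..T} \<Longrightarrow> x (fst p + s) - ?y s = c"
    by (rule has_vector_derivative_zero_constant[rotated]) auto
  from this this[of 0]
  have val: "x (fst p + s) = ?y s" if "s \<in> {0..T}" for s
    using that T x0 by (simp add: prolong_by_nonpos)
  then show "s \<in> {0..T} \<Longrightarrow> x (fst p + s) = ?y s" .
  have seg: "seg I (fst p + s) x = seg I s ?y" if s: "s \<in> {0..T}" for s
  proof -
    have "seg I (fst p + s) x = seg I s (\<lambda>r. x (fst p + r))" by (rule seg_cong) (simp add: algebra_simps)
    also have "\<dots> = seg I s ?y"
    proof (rule seg_eq_if_agree[OF past])
      have "seg I 0 (\<lambda>r. x (fst p + r)) = seg I (fst p) x" by (rule seg_cong) simp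
      then show "seg I 0 (\<lambda>r. x (fst p + r)) = seg I 0 ?y"
        unfolding seg_0_prolong_by[OF past ini_Maps] ini .
    qed (use val s in auto)
    finally show ?thesis .
  qed
  then show fut: "s \<in> {0..T} \<Longrightarrow> future p ?u s = (fst p + s, seg I (fst p + s) x)"
    by (simp add: future_def)
  show "s \<in> {0..T} \<Longrightarrow> ?u s = F (future p ?u s) - F p"
    using fut[unfolded future_def] by (simp add: excess_def hold_id future_def)
qed

lemma continuous_map_orbit:
  assumes x: "solves a b x"
  shows "continuous_map (top_of_set {a..b}) H (\<lambda>t. seg I t x)"
proof (cases "a \<le> b")
  case True
  define p where "p = (a, seg I a x)"
  have x': "solves (fst p) (fst p + (b - a)) x" and ini: "seg I (fst p) x = snd p" and T: "0 \<le> b - a"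
    using x True by (simp_all add: p_def)
  have "p \<in> D" using solvesD(1)[OF x, of a] True by (simp add: p_def)
  note rep = solution_as_prolongation[OF T x' ini]
  have "continuous_map (top_of_set {a..b}) (top_of_set {0..}) (\<lambda>t. t - a)"
    by (auto simp: continuous_map_in_subtopology intro!: continuous_intros)
  from continuous_map_compose[OF this continuous_map_seg_prolong_by[OF D_H[OF \<open>p \<in> D\<close>] rep(1)], of "F p"]
  show ?thesis
  proof (rule continuous_map_eq)
    fix t assume "t \<in> topspace (top_of_set {a..b})"
    then have "t - a \<in> {0..b - a}" by simp
    from rep(4)[OF this]
    show "((\<lambda>t. seg I t (prolong_by (snd p) (F p) (excess p (b - a) x))) \<circ> (\<lambda>t. t - a)) t = seg I t x"
      by (simp add: future_def p_def)
  qed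
next
  case False
  then show ?thesis by (simp add: continuous_map_on_empty)
qed

text \<open>
  The controls of both solutions vanish at the start, hence stay in the \<open>\<eta>\<close>-ball of a contraction box for
  a short time. The maximum of their distance is then at most half of itself.
\<close>

lemma locally_unique:
  assumes T: "0 < T" and p: "p \<in> D"
    and x: "solves (fst p) (fst p + T) x" "seg I (fst p) x = snd p"
    and y: "solves (fst p) (fst p + T) y" "seg I (fst p) y = snd p"
  shows "\<exists>e>0. e \<le> T \<and> (\<forall>s\<in>{0..e}. x (fst p + s) = y (fst p + s))"
proof -
  obtain T1 \<eta> W where box: "contraction_box T1 \<eta> W" and pW: "p \<in> W" using ex_contraction_box[OF p] by blast
  note b = contraction_boxD[OF box]
  have small: "\<exists>d>0. \<forall>s\<in>{0..T}. s < d \<longrightarrow> norm (F (fst p + s, seg I (fst p + s) z) - F p) \<le> \<eta>"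
    if z: "solves (fst p) (fst p + T) z" "seg I (fst p) z = snd p" for z
  proof -
    have "fst p \<in> {fst p..fst p + T}" using T by simp
    from solvesD(3)[OF z(1), unfolded continuous_on_iff, rule_format, OF this b(2)]
    obtain d where d: "d > 0" "\<And>t. t \<in> {fst p..fst p + T} \<Longrightarrow> dist t (fst p) < d \<Longrightarrow>
        dist (F (t, seg I t z)) (F (fst p, seg I (fst p) z)) < \<eta>" by blast
    show ?thesis
    proof (intro exI[of _ d] conjI ballI impI)
      fix s assume s: "s \<in> {0..T}" "s < d"
      then show "norm (F (fst p + s, seg I (fst p + s) z) - F p) \<le> \<eta>"
        using d(2)[of "fst p + s"] z(2) by (simp add: dist_norm)
    qed (rule d(1))
  qed
  obtain d where d: "d > 0" "\<forall>s\<in>{0..T}. s < d \<longrightarrow> norm (F (fst p + s, seg I (fst p + s) x) - F p) \<le> \<eta>"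
    using small[OF x] by blast
  obtain d' where d': "d' > 0" "\<forall>s\<in>{0..T}. s < d' \<longrightarrow> norm (F (fst p + s, seg I (fst p + s) y) - F p) \<le> \<eta>"
    using small[OF y] by blast
  define e where "e = min (min T T1) (min (d / 2) (d' / 2))"
  have e: "0 < e" "e \<le> T" "e \<le> T1" "e < d" "e < d'" using T b(1) d(1) d'(1) by (auto simp: e_def)
  have e0: "0 \<le> e" using e by simp
  have xe: "solves (fst p) (fst p + e) x" and ye: "solves (fst p) (fst p + e) y"
    using solves_subinterval[OF x(1)] solves_subinterval[OF y(1)] e by auto
  define u where "u = excess p e x"
  define w where "w = excess p e y"
  note ux = solution_as_prolongation[OF e0 xe x(2), folded u_def]
  note wy = solution_as_prolongation[OF e0 ye y(2), folded w_def]
  have he: "hold e s \<in> {0..T}" "hold e s < d" "hold e s < d'" for s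
    using hold_in[OF e0, of s] e by auto
  have "norm (u s) \<le> \<eta>" "norm (w s) \<le> \<eta>" for s
    using d(2)[rule_format, OF he(1,2)] d'(2)[rule_format, OF he(1,3)] by (simp_all add: u_def w_def excess_def)
  then have u: "control T1 \<eta> u" and w: "control T1 \<eta> w"
    using ux(1,2) wy(1,2) by (simp_all add: control_def)
  have "continuous_on {0..e} (\<lambda>s. norm (u s - w s))"
    by (intro continuous_intros continuous_on_subset[OF ux(1)] continuous_on_subset[OF wy(1)]) auto
  then obtain s0 where s0: "s0 \<in> {0..e}" "\<And>s. s \<in> {0..e} \<Longrightarrow> norm (u s - w s) \<le> norm (u s0 - w s0)"
    using continuous_attains_sup[of "{0..e}" "\<lambda>s. norm (u s - w s)"] e by auto
  have hold: "u s - w s = u (hold e s) - w (hold e s)" for s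
    using hold_id[OF hold_in[OF e0]] by (simp add: u_def w_def excess_def)
  have "norm (u s0 - w s0) = norm (F (future p u s0) - F (future p w s0))"
    using ux(5)[OF s0(1)] wy(5)[OF s0(1)] by simp
  also have "\<dots> \<le> norm (u s0 - w s0) / 2"
  proof (rule b(7)[OF pW u w])
    show "norm (u s - w s) \<le> norm (u s0 - w s0)" for s
      by (subst hold) (rule s0(2)[OF hold_in[OF e0]])
    show "s0 \<in> {0..T1}" using s0(1) e by auto
  qed
  finally have "norm (u s0 - w s0) = 0" by simp
  then have zero: "u s - w s = 0" if "s \<in> {0..e}" for s using s0(2)[OF that] by simp
  have "x (fst p + s) = y (fst p + s)" if s: "s \<in> {0..e}" for s
  proof -
    have "norm (primitive (\<lambda>s. u s - w s) s) \<le> 0 * s"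
      using s zero by (intro norm_primitive_le continuous_on_diff ux(1) wy(1)) auto
    then have "primitive u s = primitive w s" by (simp add: primitive_diff[OF ux(1) wy(1)])
    then show ?thesis using ux(3)[OF s] wy(3)[OF s] by (simp add: prolong_by_def)
  qed
  then show ?thesis using e by blast
qed

lemma solution_unique:
  assumes x: "solves a b x" and y: "solves a b y" and ini: "seg I a x = seg I a y" and t: "t \<in> {a..b}"
  shows "x t = y t"
proof -
  have ab: "a \<le> b" using t by simp
  have a: "x a = y a" using segD[OF ini past_interval_0[OF past]] by simp
  define A where "A = {t \<in> {a..b}. \<forall>s\<in>{a..t}. x s = y s}"
  define c where "c = Sup A"
  have aA: "a \<in> A" using a ab by (simp add: A_def)
  have bdd: "bdd_above A" by (rule bdd_aboveI[of _ b]) (simp add: A_def)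
  have ac: "a \<le> c" unfolding c_def using aA bdd by (rule cSup_upper)
  have cb: "c \<le> b" unfolding c_def by (rule cSup_least) (use aA in \<open>auto simp: A_def\<close>)
  have below: "x s = y s" if s: "s \<in> {a..<c}" for s
  proof -
    have "s < Sup A" using s by (simp add: c_def)
    then obtain r where "r \<in> A" "s < r" using aA less_cSupD[of A s] by blast
    then show ?thesis using s by (simp add: A_def)
  qed
  have upto: "x s = y s" if s: "s \<in> {a..c}" for s
  proof (cases "a = c")
    case True
    then show ?thesis using s a by simp
  next
    case False
    then have cl: "closure {a..<c} = {a..c}" using ac by simp
    have "continuous_on {a..b} (\<lambda>s. x s - y s)"
      by (intro continuous_on_diff continuous_on_vector_derivative[OF solvesD(2)[OF x]]
          continuous_on_vector_derivative[OF solvesD(2)[OF y]])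
    then have "continuous_on (closure {a..<c}) (\<lambda>s. x s - y s)"
      unfolding cl by (rule continuous_on_subset) (use cb in auto)
    from continuous_constant_on_closure[OF this, of 0 s] show ?thesis
      using below s cl by simp
  qed
  have "c = b"
  proof (rule ccontr)
    assume "c \<noteq> b"
    then have T: "0 < b - c" using cb by simp
    define p where "p = (c, seg I c x)"
    have yp: "seg I (fst p) y = snd p"
      using seg_eq_if_agree[OF past ini upto ac] by (simp add: p_def)
    have "p \<in> D" using solvesD(1)[OF x, of c] ac cb by (simp add: p_def)
    moreover have "solves (fst p) (fst p + (b - c)) x" "solves (fst p) (fst p + (b - c)) y"
      using solves_subinterval[OF x] solves_subinterval[OF y] ac by (simp_all add: p_def)
    moreover have "seg I (fst p) x = snd p" by (simp add: p_def)
    ultimately obtain e where e: "e > 0" "e \<le> b - c" "\<forall>s\<in>{0..e}. x (fst p + s) = y (fst p + s)"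
      using locally_unique[OF T] yp by blast
    have "x s = y s" if "s \<in> {a..c + e}" for s
      using upto[of s] e(3)[rule_format, of "s - c"] that by (cases "s \<le> c") (auto simp: p_def)
    then have "c + e \<in> A" using e ac by (auto simp: A_def)
    then have "c + e \<le> c" unfolding c_def using bdd by (rule cSup_upper)
    then show False using e by simp
  qed
  then show ?thesis using upto t by simp
qed

text \<open>
  The solution from \<open>p\<close>, in absolute time, that belongs to the fixed point.
\<close>

definition local_solution :: "real \<Rightarrow> real \<Rightarrow> real \<times> (real \<Rightarrow> 'e) \<Rightarrow> real \<Rightarrow> 'e" where
  "local_solution T \<eta> p t = prolong_by (snd p) (F p) (apply_bcontfun (solution_excess T \<eta> p)) (t - fst p)"

lemma future_solution_excess: "(fst p + s, seg I (fst p + s) (local_solution T \<eta> p)) = future p (apply_bcontfun (solution_excess T \<eta> p)) s"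
  unfolding future_def prod.inject by (intro conjI refl seg_cong) (simp add: local_solution_def algebra_simps)

lemma local_solution_solves:
  assumes box: "contraction_box T \<eta> W" and p: "p \<in> W"
  shows "solves (fst p) (fst p + T) (local_solution T \<eta> p)" "seg I (fst p) (local_solution T \<eta> p) = snd p"
proof -
  note b = contraction_boxD[OF box]
  define u where "u = apply_bcontfun (solution_excess T \<eta> p)"
  have u: "control T \<eta> u" using solution_excess(1)[OF box p] by (simp add: controls_def u_def)
  then have uc: "continuous_on UNIV u" by (simp add: control_def)
  have fut: "(t, seg I t (local_solution T \<eta> p)) = future p u (t - fst p)" for t
    using future_solution_excess[of p "t - fst p"] by (simp add: u_def)
  have fix_u: "F (future p u s) = F p + u s" if "s \<in> {0..T}" for s
    using apply_picard[OF box p solution_excess(1)[OF box p]] solution_excess(2)[OF box p] hold_id[OF that]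
    by (metis (no_types, lifting) u_def add.commute diff_add_cancel)
  have Ft: "F (t, seg I t (local_solution T \<eta> p)) = F p + u (t - fst p)" if "t \<in> {fst p..fst p + T}" for t
    unfolding fut using that by (intro fix_u) auto
  have "continuous_on {fst p..fst p + T} (\<lambda>t. F p + u (t - fst p))"
    by (intro continuous_intros continuous_on_compose2[OF uc]) auto
  then have "continuous_on {fst p..fst p + T} (\<lambda>t. F (t, seg I t (local_solution T \<eta> p)))"
    by (rule continuous_on_eq) (simp add: Ft)
  moreover have "(local_solution T \<eta> p has_vector_derivative F (t, seg I t (local_solution T \<eta> p))) (at t within {fst p..fst p + T})"
    if t: "t \<in> {fst p..fst p + T}" for t
  proof -
    have "((\<lambda>t. prolong_by (snd p) (F p) u (t - fst p)) has_vector_derivative 1 *\<^sub>R (F p + u (t - fst p)))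
        (at t within {fst p..fst p + T})"
      using t
      by (intro vector_diff_chain_within[of "\<lambda>s. s - fst p" 1 t _ "prolong_by (snd p) (F p) u", unfolded o_def]
          has_vector_derivative_within_subset[OF has_vector_derivative_prolong_by[OF uc]])
         (auto intro!: derivative_eq_intros)
    moreover have "local_solution T \<eta> p = (\<lambda>t. prolong_by (snd p) (F p) u (t - fst p))"
      by (simp add: local_solution_def u_def fun_eq_iff)
    ultimately show ?thesis unfolding Ft[OF t] by simp
  qed
  moreover have "(t, seg I t (local_solution T \<eta> p)) \<in> D" if "t \<in> {fst p..fst p + T}" for t
    unfolding fut using that by (intro b(5)[OF p u]) auto
  ultimately show "solves (fst p) (fst p + T) (local_solution T \<eta> p)" by (simp add: solves_def)
  show "seg I (fst p) (local_solution T \<eta> p) = snd p"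
  proof -
    have "(fst p, seg I (fst p) (local_solution T \<eta> p)) = p" using fut[of "fst p"] future_0[of p u] b(4) p by auto
    then show ?thesis by (metis snd_conv)
  qed
qed

lemma continuous_map_local_solution:
  assumes box: "contraction_box T \<eta> W"
  shows "continuous_map (prod_topology (top_of_set {0..T}) (subtopology RH W)) H
     (\<lambda>z. seg I (fst (snd z) + fst z) (local_solution T \<eta> (snd z)))"
proof (rule continuous_map_eq[OF continuous_map_seg_prolong_by_solution_excess[OF box]])
  show "seg I (fst z) (prolong_by (snd (snd z)) (F (snd z)) (apply_bcontfun (solution_excess T \<eta> (snd z)))) =
      seg I (fst (snd z) + fst z) (local_solution T \<eta> (snd z))" for z
    using future_solution_excess[of "snd z" "fst z" T \<eta>] by (simp add: future_def)
qed

end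

section \<open>Maximal solutions and the solution process\<close>

context history_ivp
begin

definition lifetimes :: "real \<times> (real \<Rightarrow> 'e) \<Rightarrow> real set" where
  "lifetimes p = {T. 0 \<le> T \<and> (\<exists>x. seg I (fst p) x = snd p \<and> solves (fst p) (fst p + T) x)}"

definition max_time :: "real \<times> (real \<Rightarrow> 'e) \<Rightarrow> ereal" where
  "max_time p = (SUP T\<in>lifetimes p. ereal T)"

lemma ex_local_solution:
  assumes p: "p \<in> D"
  shows "\<exists>T>0. \<exists>x. solves (fst p) (fst p + T) x \<and> seg I (fst p) x = snd p"
proof -
  obtain T \<eta> W where "contraction_box T \<eta> W" "p \<in> W" using ex_contraction_box[OF p] by blast
  from contraction_boxD(1)[OF this(1)] local_solution_solves[OF this] show ?thesis by blast
qed

text \<open>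
  The supremum is not attained: at the end of a solution on a compact interval its segment is again a
  datum in the domain, from which a local solution continues it.
\<close>

lemma lifetimes_iff:
  assumes p: "p \<in> D"
  shows "T \<in> lifetimes p \<longleftrightarrow> 0 \<le> T \<and> ereal T < max_time p"
proof
  assume T: "T \<in> lifetimes p"
  then obtain x where x: "seg I (fst p) x = snd p" "solves (fst p) (fst p + T) x" and T0: "0 \<le> T"
    by (auto simp: lifetimes_def)
  define q where "q = (fst p + T, seg I (fst p + T) x)"
  have "q \<in> D" using solvesD(1)[OF x(2), of "fst p + T"] T0 by (simp add: q_def)
  from ex_local_solution[OF this] obtain S z where S: "S > 0"
    and z: "solves (fst p + T) (fst p + T + S) z" "seg I (fst p + T) z = seg I (fst p + T) x"
    by (auto simp: q_def)
  have "solves (fst p) (fst p + (T + S)) (glue (fst p + T) x z)"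
    using solves_glue[OF x(2) z] T0 S by (simp add: add.assoc)
  moreover have "seg I (fst p) (glue (fst p + T) x z) = snd p"
    using T0 x(1) by (simp add: seg_glue_left)
  ultimately have "T + S \<in> lifetimes p" using T0 S by (auto simp: lifetimes_def)
  then have "ereal (T + S) \<le> max_time p" unfolding max_time_def by (rule SUP_upper)
  moreover have "ereal T < ereal (T + S)" using S by simp
  ultimately show "0 \<le> T \<and> ereal T < max_time p" using T0 by (metis less_le_trans)
next
  assume T: "0 \<le> T \<and> ereal T < max_time p"
  then obtain S where S: "S \<in> lifetimes p" "T < S" unfolding max_time_def less_SUP_iff by auto
  then obtain x where "seg I (fst p) x = snd p" "solves (fst p) (fst p + S) x"
    by (auto simp: lifetimes_def)
  with S T show "T \<in> lifetimes p"
    using solves_subinterval[of "fst p" "fst p + S" x "fst p" "fst p + T"] by (auto simp: lifetimes_def)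
qed

lemma max_time_pos: assumes p: "p \<in> D" shows "0 < max_time p"
proof -
  from ex_local_solution[OF p] obtain T where "T > 0" "T \<in> lifetimes p"
    by (auto simp: lifetimes_def)
  then show ?thesis using lifetimes_iff[OF p, of T] by (metis ereal_less_eq(5) le_less_trans)
qed

definition some_solution :: "real \<times> (real \<Rightarrow> 'e) \<Rightarrow> real \<Rightarrow> real \<Rightarrow> 'e" where
  "some_solution p T = (SOME x. seg I (fst p) x = snd p \<and> solves (fst p) (fst p + T) x)"

text \<open>
  By uniqueness it does not matter which solution is consulted at time \<open>t\<close>; the one on exactly
  \<open>[fst p, t]\<close> is taken. The values \<open>0\<close> make the map vanish off \<open>life_span p + I\<close>.
\<close>

definition max_solution :: "real \<times> (real \<Rightarrow> 'e) \<Rightarrow> real \<Rightarrow> 'e" where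
  "max_solution p t =
     (if t < fst p then (if t - fst p \<in> I then snd p (t - fst p) else 0)
      else if ereal (t - fst p) < max_time p then some_solution p (t - fst p) t else 0)"

lemma some_solution:
  assumes "T \<in> lifetimes p"
  shows "seg I (fst p) (some_solution p T) = snd p" "solves (fst p) (fst p + T) (some_solution p T)"
proof -
  have "\<exists>x. seg I (fst p) x = snd p \<and> solves (fst p) (fst p + T) x" using assms by (auto simp: lifetimes_def)
  from someI_ex[OF this] show "seg I (fst p) (some_solution p T) = snd p" "solves (fst p) (fst p + T) (some_solution p T)"
    unfolding some_solution_def by blast+
qed

lemma max_solution_agrees:
  assumes p: "p \<in> D" and x: "solves (fst p) b x" "seg I (fst p) x = snd p" and t: "t \<in> {fst p..b}"
  shows "max_solution p t = x t"
proof -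
  have sub: "solves (fst p) t x" using solves_subinterval[OF x(1)] t by simp
  then have T: "t - fst p \<in> lifetimes p" using x(2) t by (auto simp: lifetimes_def)
  note s = some_solution[OF T]
  have "solves (fst p) t (some_solution p (t - fst p))" using s(2) by simp
  then have "some_solution p (t - fst p) t = x t"
    using t s(1) x(2) by (intro solution_unique[OF _ sub]) auto
  then show ?thesis using t lifetimes_iff[OF p] T by (simp add: max_solution_def)
qed

lemma seg_max_solution_ini:
  assumes p: "p \<in> D"
  shows "seg I (fst p) (max_solution p) = snd p"
proof -
  obtain T x where T: "T > 0" and x: "solves (fst p) (fst p + T) x" "seg I (fst p) x = snd p"
    using ex_local_solution[OF p] by blast
  have "seg I (fst p) (max_solution p) = seg I (fst p) x"
  proof (rule seg_cong)
    fix \<theta> assume \<theta>: "\<theta> \<in> I"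
    show "max_solution p (fst p + \<theta>) = x (fst p + \<theta>)"
    proof (cases "\<theta> = 0")
      case True
      then show ?thesis using max_solution_agrees[OF p x, of "fst p"] T by simp
    next
      case False
      then have "\<theta> < 0" using past_interval_nonpos[OF past \<theta>] by simp
      moreover have "snd p \<theta> = x (fst p + \<theta>)" using \<theta> unfolding x(2)[symmetric] by (simp add: seg_def)
      ultimately show ?thesis using \<theta> by (simp add: max_solution_def)
    qed
  qed
  with x(2) show ?thesis by simp
qed

lemma seg_max_solution:
  assumes p: "p \<in> D" and x: "solves (fst p) b x" "seg I (fst p) x = snd p" and t: "t \<in> {fst p..b}"
  shows "seg I t (max_solution p) = seg I t x"
proof (rule seg_eq_if_agree[OF past])
  show "seg I (fst p) (max_solution p) = seg I (fst p) x" unfolding seg_max_solution_ini[OF p] x(2) ..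
  show "max_solution p s = x s" if "s \<in> {fst p..t}" for s
    using that t by (intro max_solution_agrees[OF p x]) simp
qed (use t in simp)

lemma max_solution_solves:
  assumes p: "p \<in> D" and t: "0 \<le> \<tau>" "ereal \<tau> < max_time p"
  shows "solves (fst p) (fst p + \<tau>) (max_solution p)"
proof -
  have "\<tau> \<in> lifetimes p" using lifetimes_iff[OF p] t by simp
  note s = some_solution[OF this]
  show ?thesis
  proof (rule solves_cong[OF s(2)])
    show "max_solution p (r + \<theta>) = some_solution p \<tau> (r + \<theta>)" if "r \<in> {fst p..fst p + \<tau>}" "\<theta> \<in> I" for r \<theta>
      using seg_max_solution[OF p s(2,1) that(1)] that(2) by (rule segD)
  qed
qed

lemma solves_within_max_time:
  assumes p: "p \<in> D" and x: "solves (fst p) t x" "seg I (fst p) x = snd p" and t: "fst p \<le> t"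
  shows "ereal (t - fst p) < max_time p"
proof -
  have "t - fst p \<in> lifetimes p" using x t by (auto simp: lifetimes_def)
  then show ?thesis using lifetimes_iff[OF p] by simp
qed

definition life_span :: "real \<times> (real \<Rightarrow> 'e) \<Rightarrow> real set" where
  "life_span p = {t. fst p \<le> t \<and> ereal (t - fst p) < max_time p}"

lemma C1_solution_solves:
  assumes x: "is_C1_solution I D F a \<psi> J x" and t: "t \<in> J"
  shows "solves a t x"
proof -
  have J: "left_end_interval a J" and sol: "\<And>t. t \<in> J \<Longrightarrow> (t, seg I t x) \<in> D"
      "\<And>t. t \<in> J \<Longrightarrow> (x has_vector_derivative F (t, seg I t x)) (at t within J)" and C1: "C1_on J x"
    using x by (auto simp: is_C1_solution_def is_solution_def)
  have sub: "{a..t} \<subseteq> J"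
    using J t unfolding left_end_interval_def is_interval_1 by (auto intro: order.trans)
  obtain f' where f': "continuous_on J f'" "\<And>t. t \<in> J \<Longrightarrow> (x has_vector_derivative f' t) (at t within J)"
    using C1 by (auto simp: C1_on_def)
  have "continuous_on {a..t} (\<lambda>t. F (t, seg I t x))"
  proof (cases "a < t")
    case True
    have "f' r = F (r, seg I r x)" if r: "r \<in> {a..t}" for r
      using has_vector_derivative_within_subset[OF f'(2) sub, of r]
        has_vector_derivative_within_subset[OF sol(2) sub, of r] r sub True
      by (intro vector_derivative_unique_within_closed_interval[of a t r x]) auto
    with continuous_on_subset[OF f'(1) sub] show ?thesis by (rule continuous_on_eq)
  next
    case False
    then have "{a..t} \<subseteq> {t}" by auto
    then show ?thesis using continuous_on_subset[OF continuous_on_sing] by blast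
  qed
  moreover have "(x has_vector_derivative F (r, seg I r x)) (at r within {a..t})" if "r \<in> {a..t}" for r
    using sub that by (intro has_vector_derivative_within_subset[OF sol(2) sub]) auto
  ultimately show ?thesis using sol(1) sub by (auto simp: solves_def)
qed

lemma life_span:
  assumes p: "p \<in> D"
  shows "left_end_interval (fst p) (life_span p)" "life_span p \<noteq> {fst p}"
    and "\<And>t. t \<in> life_span p \<Longrightarrow> \<exists>t'>t. t' \<in> life_span p"
proof -
  show "left_end_interval (fst p) (life_span p)"
    using max_time_pos[OF p]
    by (auto simp: left_end_interval_def is_interval_1 life_span_def zero_ereal_def
        intro: le_less_trans[of "ereal (x - fst p)" "ereal (y - fst p)" for x y])
  show larger: "\<exists>t'>t. t' \<in> life_span p" if t: "t \<in> life_span p" for t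
  proof -
    obtain r where "ereal (t - fst p) < ereal r" "ereal r < max_time p"
      using t ereal_dense2[of "ereal (t - fst p)" "max_time p"] by (auto simp: life_span_def)
    then show ?thesis using t by (intro exI[of _ "fst p + r"]) (auto simp: life_span_def)
  qed
  have "fst p \<in> life_span p" using max_time_pos[OF p] by (simp add: life_span_def zero_ereal_def)
  from larger[OF this] show "life_span p \<noteq> {fst p}" by auto
qed

lemma max_solution_C1:
  assumes p: "p \<in> D"
  shows "is_C1_solution I D F (fst p) (snd p) (life_span p) (max_solution p)"
proof -
  let ?J = "life_span p" and ?x = "max_solution p"
  have local: "(t, seg I t ?x) \<in> D" "(?x has_vector_derivative F (t, seg I t ?x)) (at t within ?J)"
    "continuous (at t within ?J) (\<lambda>t. F (t, seg I t ?x))" if t: "t \<in> ?J" for t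
  proof -
    obtain t' where t': "t < t'" "t' \<in> ?J" using life_span(3)[OF p t] by blast
    have x: "solves (fst p) t' ?x" using max_solution_solves[OF p, of "t' - fst p"] t' by (simp add: life_span_def)
    have tt: "t \<in> {fst p..t'}" using t t' by (simp add: life_span_def)
    have "r \<in> ?J" if "fst p \<le> r" "r \<le> t'" for r
      using life_span(1)[OF p] t' that unfolding left_end_interval_def is_interval_1 by blast
    then have w: "at t within ?J = at t within {fst p..t'}"
      using t' by (intro at_within_nhd[of t "{..<t'}"]) (auto simp: life_span_def)
    show "(t, seg I t ?x) \<in> D" using solvesD(1)[OF x tt] .
    show "(?x has_vector_derivative F (t, seg I t ?x)) (at t within ?J)" unfolding w using solvesD(2)[OF x tt] .
    show "continuous (at t within ?J) (\<lambda>t. F (t, seg I t ?x))"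
      unfolding w using solvesD(3)[OF x] tt by (simp add: continuous_on_eq_continuous_within)
  qed
  have "?x \<in> Maps (?J + I)"
    unfolding Maps_def
  proof (intro CollectI allI impI)
    fix t assume t: "t \<notin> ?J + I"
    have "fst p \<in> ?J" using life_span(1)[OF p] by (simp add: left_end_interval_def)
    then have "t - fst p \<notin> I" using t set_plus_intro[of "fst p" ?J "t - fst p" I] by auto
    moreover have "t \<notin> ?J" using t set_plus_intro[of t ?J 0 I] past_interval_0[OF past] by auto
    ultimately show "?x t = 0" by (auto simp: max_solution_def life_span_def)
  qed
  moreover have "C1_on ?J ?x" unfolding C1_on_def
  proof (intro exI[of _ "\<lambda>t. F (t, seg I t ?x)"] conjI ballI)
    show "continuous_on ?J (\<lambda>t. F (t, seg I t ?x))"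
      unfolding continuous_on_eq_continuous_within using local(3) by blast
  qed (rule local(2))
  ultimately show ?thesis
    using local life_span[OF p] seg_max_solution_ini[OF p] by (simp add: is_C1_solution_def is_solution_def)
qed

lemma Maps_plus_eqI:
  assumes x: "x \<in> Maps (J + I)" and y: "y \<in> Maps (J + I)" and J: "left_end_interval a J"
    and ini: "seg I a x = seg I a y" and eq: "\<And>t. t \<in> J \<Longrightarrow> x t = y t"
  shows "x = y"
proof
  fix t show "x t = y t"
  proof (cases "t \<in> J + I")
    case True
    then obtain s \<theta> where s: "s \<in> J" "\<theta> \<in> I" "t = s + \<theta>" by (rule set_plus_elim)
    have "seg I s x = seg I s y"
    proof (rule seg_eq_if_agree[OF past ini eq])
      show "a \<le> s" using J s(1) by (auto simp: left_end_interval_def)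
      show "r \<in> J" if "r \<in> {a..s}" for r
        using J s(1) that mem_is_interval_1_I[of J a s r] by (auto simp: left_end_interval_def)
    qed
    from segD[OF this s(2)] show ?thesis using s(3) by simp
  next
    case False
    then show ?thesis using x y by (simp add: Maps_def)
  qed
qed

text \<open>
  The maximal solution extends every \<open>C\<^sup>1\<close> solution, so it is the only maximal element.
\<close>

lemma maximal_C1_solution_iff:
  assumes p: "p \<in> D"
  shows "is_maximal_C1_solution I D F (fst p) (snd p) J x \<longleftrightarrow> J = life_span p \<and> x = max_solution p"
proof -
  let ?J = "life_span p" and ?x = "max_solution p"
  have below: "K \<subseteq> ?J \<and> (\<forall>t\<in>K. z t = ?x t)" if z: "is_C1_solution I D F (fst p) (snd p) K z" for K z
  proof -
    have ini: "seg I (fst p) z = snd p" and K: "left_end_interval (fst p) K"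
      using z by (auto simp: is_C1_solution_def is_solution_def)
    have "t \<in> ?J \<and> z t = ?x t" if t: "t \<in> K" for t
    proof -
      have "fst p \<le> t" using K t by (auto simp: left_end_interval_def)
      then show ?thesis
        using C1_solution_solves[OF z t] ini solves_within_max_time[OF p] max_solution_agrees[OF p, of t z t]
        by (simp add: life_span_def)
    qed
    then show ?thesis by blast
  qed
  have same: "z = ?x" if z: "is_C1_solution I D F (fst p) (snd p) ?J z" for z
    using z max_solution_C1[OF p] below[OF z] life_span(1)[OF p]
    by (intro Maps_plus_eqI[of z ?J ?x "fst p"]) (auto simp: is_C1_solution_def is_solution_def)
  show ?thesis
  proof
    assume x: "is_maximal_C1_solution I D F (fst p) (snd p) J x"
    then have "is_C1_solution I D F (fst p) (snd p) J x" by (simp add: is_maximal_C1_solution_def)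
    from below[OF this] have "sol_le J x ?J ?x" by (simp add: sol_le_def)
    with x max_solution_C1[OF p] show "J = ?J \<and> x = ?x" unfolding is_maximal_C1_solution_def by blast
  next
    assume J: "J = ?J \<and> x = ?x"
    have "K = ?J \<and> z = ?x" if z: "is_C1_solution I D F (fst p) (snd p) K z" and le: "sol_le ?J ?x K z" for K z
    proof -
      have "K = ?J" using below[OF z] le by (auto simp: sol_le_def)
      with same z show ?thesis by blast
    qed
    then show "is_maximal_C1_solution I D F (fst p) (snd p) J x"
      using J max_solution_C1[OF p] unfolding is_maximal_C1_solution_def by blast
  qed
qed

text \<open>
  The semiflow on the domain of \<open>F\<close> that belongs to the solution process: time is part of the state.
\<close>

definition evolve :: "real \<times> real \<times> (real \<Rightarrow> 'e) \<Rightarrow> real \<times> (real \<Rightarrow> 'e)" where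
  "evolve z = (fst (snd z) + fst z, seg I (fst (snd z) + fst z) (max_solution (snd z)))"

definition evolve_dom :: "(real \<times> real \<times> (real \<Rightarrow> 'e)) set" where
  "evolve_dom = (\<Union>p\<in>D. {\<tau>. 0 \<le> \<tau> \<and> ereal \<tau> < max_time p} \<times> {p})"

lemma evolve_dom_iff: "(\<tau>, p) \<in> evolve_dom \<longleftrightarrow> p \<in> D \<and> 0 \<le> \<tau> \<and> ereal \<tau> < max_time p"
  by (auto simp: evolve_dom_def)

lemma evolve_in_D: "(\<tau>, p) \<in> evolve_dom \<Longrightarrow> evolve (\<tau>, p) \<in> D"
  using solvesD(1)[OF max_solution_solves, of p \<tau> "fst p + \<tau>"] by (auto simp: evolve_dom_iff evolve_def)

text \<open>
  The maximal solution from the state at time \<open>\<tau>\<close>, glued to the maximal solution up to \<open>\<tau>\<close>, solves the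
  original problem; uniqueness identifies it with the original maximal solution.
\<close>

lemma evolve_add:
  assumes 1: "(\<tau>, p) \<in> evolve_dom" and 2: "(\<sigma>, evolve (\<tau>, p)) \<in> evolve_dom"
  shows "(\<tau> + \<sigma>, p) \<in> evolve_dom \<and> evolve (\<tau> + \<sigma>, p) = evolve (\<sigma>, evolve (\<tau>, p))"
proof -
  define q where "q = evolve (\<tau>, p)"
  have p: "p \<in> D" "0 \<le> \<tau>" "ereal \<tau> < max_time p" and q: "q \<in> D" "0 \<le> \<sigma>" "ereal \<sigma> < max_time q"
    using 1 2 by (auto simp: evolve_dom_iff q_def)
  let ?b = "fst p + \<tau>"
  let ?x = "max_solution p" and ?z = "max_solution q"
  have fq: "fst q = ?b" and sq: "snd q = seg I ?b ?x" by (auto simp: q_def evolve_def)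
  have x: "solves (fst p) ?b ?x" by (rule max_solution_solves[OF p])
  have z: "solves ?b (?b + \<sigma>) ?z" using max_solution_solves[OF q] by (simp add: fq)
  have seg: "seg I ?b ?z = seg I ?b ?x" using seg_max_solution_ini[OF q(1)] by (simp add: fq sq)
  have g: "solves (fst p) (?b + \<sigma>) (glue ?b ?x ?z)" using p q by (intro solves_glue[OF x z seg]) auto
  have gi: "seg I (fst p) (glue ?b ?x ?z) = snd p"
    using p seg_max_solution_ini[OF p(1)] by (simp add: seg_glue_left)
  have "ereal (\<tau> + \<sigma>) < max_time p" using solves_within_max_time[OF p(1) g gi] p q by (simp add: add.assoc)
  moreover have "seg I (?b + \<sigma>) ?x = seg I (?b + \<sigma>) ?z"
    using seg_max_solution[OF p(1) g gi, of "?b + \<sigma>"] seg_glue_right[OF seg, of "?b + \<sigma>"] p q by simp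
  ultimately have "(\<tau> + \<sigma>, p) \<in> evolve_dom" "evolve (\<tau> + \<sigma>, p) = evolve (\<sigma>, q)"
    using p q by (simp_all add: evolve_dom_iff evolve_def fq add.assoc)
  then show ?thesis by (simp add: q_def)
qed

lemma evolve_maximal_semiflow: "maximal_semiflow phase evolve_dom evolve"
  unfolding maximal_semiflow_def topspace_phase
proof (intro conjI exI[of _ max_time] ballI allI impI)
  show "evolve ` evolve_dom \<subseteq> D" using evolve_in_D by auto
  show "evolve_dom = (\<Union>p\<in>D. {\<tau>. 0 \<le> \<tau> \<and> ereal \<tau> < max_time p} \<times> {p})" by (rule evolve_dom_def)
  show "evolve (0, p) = p" if "p \<in> D" for p using seg_max_solution_ini[OF that] by (simp add: evolve_def)
qed (use max_time_pos evolve_add in blast)+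

lemma continuous_map_phaseI:
  assumes "continuous_map Z euclideanreal f" "continuous_map Z H g" "\<And>z. z \<in> topspace Z \<Longrightarrow> (f z, g z) \<in> D"
  shows "continuous_map Z phase (\<lambda>z. (f z, g z))"
  using assms by (auto simp: continuous_map_in_subtopology intro!: continuous_map_pairedI)

lemma evolve_continuous: "continuous_maximal_semiflow phase evolve_dom evolve"
proof (rule continuous_maximal_semiflowI[OF evolve_maximal_semiflow])
  fix p t assume pt: "(t, p) \<in> evolve_dom"
  then have p: "p \<in> D" "0 \<le> t" "ereal t < max_time p" by (auto simp: evolve_dom_iff)
  note x = max_solution_solves[OF p]
  have "continuous_map (top_of_set {0..t}) (top_of_set {fst p..fst p + t}) (\<lambda>s. fst p + s)"
    by (auto simp: continuous_map_in_subtopology intro!: continuous_intros)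
  from continuous_map_compose[OF this continuous_map_orbit[OF x]]
  show "continuous_map (top_of_set {0..t}) phase (\<lambda>s. evolve (s, p))"
    unfolding evolve_def fst_conv snd_conv
    using solvesD(1)[OF x]
    by (intro continuous_map_phaseI) (auto simp: o_def intro!: continuous_intros)
next
  fix p assume "p \<in> topspace phase"
  then have "p \<in> D" by (simp add: topspace_phase)
  then obtain T \<eta> W where box: "contraction_box T \<eta> W" and pW: "p \<in> W" using ex_contraction_box by blast
  note b = contraction_boxD[OF box]
  have seg: "seg I (fst q + t) (max_solution q) = seg I (fst q + t) (local_solution T \<eta> q)"
    and dom: "(t, q) \<in> evolve_dom" if "q \<in> W" "t \<in> {0..T}" for q t
  proof -
    have q: "q \<in> D" using that b(4) by auto
    note f = local_solution_solves[OF box that(1)]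
    have f': "solves (fst q) (fst q + t) (local_solution T \<eta> q)" using solves_subinterval[OF f(1)] that by simp
    show "seg I (fst q + t) (max_solution q) = seg I (fst q + t) (local_solution T \<eta> q)"
      using that by (intro seg_max_solution[OF q f]) auto
    show "(t, q) \<in> evolve_dom" using solves_within_max_time[OF q f' f(2)] that q by (simp add: evolve_dom_iff)
  qed
  let ?Z = "prod_topology (top_of_set {0..T}) (subtopology RH W)"
  have topZ: "topspace ?Z = {0..T} \<times> W" using b(4) D_subset by auto
  have "continuous_map ?Z H (\<lambda>z. seg I (fst (snd z) + fst z) (max_solution (snd z)))"
    by (rule continuous_map_eq[OF continuous_map_local_solution[OF box]]) (use seg topZ in auto)
  moreover have "continuous_map ?Z euclideanreal (\<lambda>z. fst (snd z) + fst z)"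
  proof (intro continuous_map_add)
    show "continuous_map ?Z euclideanreal fst"
      using continuous_map_fst[of "top_of_set {0..T}" "subtopology RH W"]
      by (simp add: continuous_map_in_subtopology)
    show "continuous_map ?Z euclideanreal (\<lambda>z. fst (snd z))"
      using continuous_map_snd[of "top_of_set {0..T}" "subtopology RH W"]
      by (simp add: continuous_map_in_subtopology continuous_map_pairwise o_def)
  qed
  ultimately have "continuous_map ?Z phase evolve"
    unfolding evolve_def[abs_def] using evolve_in_D[OF dom] topZ
    by (intro continuous_map_phaseI) (auto simp: evolve_def)
  moreover have "?Z = subtopology (prod_topology euclideanreal phase) ({0..T} \<times> W)"
    using b(4) by (simp add: subtopology_Times subtopology_subtopology Int_absorb1)
  ultimately have "continuous_map (subtopology (prod_topology euclideanreal phase) ({0..T} \<times> W)) phase evolve"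
    by simp
  moreover have "{0..T} \<times> W \<subseteq> evolve_dom" using dom by auto
  ultimately show "\<exists>T>0. \<exists>U. openin phase U \<and> p \<in> U \<and> {0..T} \<times> U \<subseteq> evolve_dom \<and>
      continuous_map (subtopology (prod_topology euclideanreal phase) ({0..T} \<times> U)) phase evolve"
    using b(1,3) pW by blast
qed

lemma well_posed: "maximally_well_posed_C1 I H D F"
  unfolding maximally_well_posed_C1_def
proof (intro exI[of _ max_time] exI[of _ max_solution] conjI)
  show "\<forall>(t0, \<phi>0)\<in>D. 0 < max_time (t0, \<phi>0) \<and>
      (\<forall>J x. is_maximal_C1_solution I D F t0 \<phi>0 J x \<longleftrightarrow>
         J = {t. t0 \<le> t \<and> ereal (t - t0) < max_time (t0, \<phi>0)} \<and> x = max_solution (t0, \<phi>0))"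
    using max_time_pos maximal_C1_solution_iff by (fastforce simp: life_span_def)
  have "(\<Union>(t0, \<phi>0)\<in>D. {\<tau>. 0 \<le> \<tau> \<and> ereal \<tau> < max_time (t0, \<phi>0)} \<times> {(t0, \<phi>0)}) = evolve_dom"
    by (auto simp: evolve_dom_def)
  moreover have "(\<lambda>(\<tau>, t, x). (t + \<tau>, (\<lambda>(\<tau>, t0, \<phi>0). seg I (t0 + \<tau>) (max_solution (t0, \<phi>0))) (\<tau>, t, x))) = evolve"
    by (auto simp: evolve_def)
  ultimately show "continuous_maximal_process H D
      (\<Union>(t0, \<phi>0)\<in>D. {\<tau>. 0 \<le> \<tau> \<and> ereal \<tau> < max_time (t0, \<phi>0)} \<times> {(t0, \<phi>0)})
      (\<lambda>(\<tau>, t0, \<phi>0). seg I (t0 + \<tau>) (max_solution (t0, \<phi>0)))"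
    unfolding continuous_maximal_process_def using evolve_continuous by simp
qed

end

theorem theorem3:
  fixes I :: "real set"
    and H :: "(real \<Rightarrow> 'e::banach) topology"
    and D :: "(real \<times> (real \<Rightarrow> 'e)) set"
    and F :: "real \<times> (real \<Rightarrow> 'e) \<Rightarrow> 'e"
  assumes "past_interval I"
    and "history_space I H"
    and "D \<subseteq> UNIV \<times> topspace H"
    and "C1_prolongable I H"
    and "regulated_by_C1_prolongations I H"
    and "continuous_map (subtopology (prod_topology euclideanreal H) D) euclidean F"
    and "\<forall>p0\<in>D. uniform_nbhd_by_C1_prolongations I H D p0"
    and "unif_loc_Lipschitz_about_C1_prolongations I H D F"
    and "continuous_map (prod_topology (top_of_set {0..}) (prod_topology euclidean H)) H
           (\<lambda>(t, v, \<phi>). S_shift I v t \<phi>)"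
  shows "maximally_well_posed_C1 I H D F"
proof -
  interpret history_ivp I H D F using assms by (rule history_ivp.intro)
  show ?thesis by (rule well_posed)
qed

end
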